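(* Let $A$ be a pro-$C^{*}$-algebra, let $E$ be a Hilbert $A$-module which is countably generated in its multiplier module $M(E)$, and let $\{h_n\}_n$ and $\{t_n\}_n$ be two standard frames of multipliers in $E$ with frame transforms $\theta_1$ and $\theta_2$ respectively. Then these frames of multipliers are duals to each other if and only if $\theta_1^{*}\circ\theta_2=\mathrm{id}_E$.
   Context: A pro-$C^{*}$-algebra $A$ is a complete Hausdorff topological $*$-algebra over $\mathbb{C}$ whose topology is given by a directed family of $C^{*}$-seminorms; $S(A)$ is the directed set of all continuous $C^{*}$-seminorms on $A$ (no unit is assumed). A pre-Hilbert $A$-module is a complex vector space $E$ that is a right $A$-module (compatibly with the complex algebra structure) with an $A$-valued inner product $\langle\cdot,\cdot\rangle_E$, $\mathbb{C}$- and $A$-linear in the second variable, with $\langle\xi,\eta\rangle_E^{*}=\langle\eta,\xi\rangle_E$, $\langle\xi,\xi\rangle_E\ge 0$, and $\langle\xi,\xi\rangle_E=0$ iff $\xi=0$. It is a Hilbert $A$-module if it is complete for the topology given by the seminorms $\overline{p}_E(\xi)=\sqrt{p(\langle\xi,\xi\rangle_E)}$, $p\in S(A)$. $A$ itself is a Hilbert $A$-module with $\langle a,b\rangle_A=a^{*}b$. $L(E,F)$ denotes the set of adjointable module morphisms $T:E\to F$ between Hilbert $A$-modules (those having a module morphism $T^{*}:F\to E$ with $\langle T\xi,\eta\rangle_F=\langle\xi,T^{*}\eta\rangle_E$), topologized by the seminorms $\widetilde{p}_{L(E,F)}(T)=\sup\{\overline{p}_F(T\xi): \xi\in E,\ \overline{p}_E(\xi)\le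 1\}$, $p\in S(A)$. The multiplier module of $E$ is $M(E)=L(A,E)$, a Hilbert module over $M(A)=L(A,A)$ with action $T\cdot S=T\circ S$ and inner product $\langle T,R\rangle_{M(E)}=T^{*}\circ R$. $E$ is identified with a submodule of $M(E)$ through $\xi\mapsto(a\mapsto \xi a)$. For $h\in M(E)$, $\xi\in E$, $a\in A$: $\langle h,\xi\rangle_{M(E)}=h^{*}(\xi)\in A$, $\langle\xi,h\rangle_{M(E)}=h^{*}(\xi)^{*}$, and $h\cdot a$ is identified with $h(a)\in E$. $E$ is countably generated in $M(E)$ if there is a countable set $\{g_n\}_{n\ge1}\subseteq M(E)$ such that the closed submodule of $M(E)$ generated by $\{g_n\cdot a: a\in A,\ n=1,2,\dots\}$ is the whole of $E$. A sequence $\{h_n\}_n$ in $M(E)$ is a standard frame of multipliers in $E$ if for each $\xi\in E$ the series $\sum_n\langle\xi,h_n\rangle_{M(E)}\langle h_n,\xi\rangle_{M(E)}$ converges in $A$ and there are positive constants $C,D$ with $C\langle\xi,\xi\rangle_E\le\sum_n\langle\xi,h_n\rangle_{M(E)}\langle h_n,\xi\rangle_{M(E)}\le D\langle\xi,\xi\rangle_E$ for all $\xi\in E$. $H_A$ is the Hilbert $A$-module of all sequences $(a_n)_n$ in $A$ such that $\sum_n a_n^{*}a_n$ converges in $A$, with $(a_n)_nb=(a_nb)_n$ and $\langle(a_n)_n,(b_n)_n\rangle_{H_A}=\sum_na_n^{*}b_n$. The frame transform of a standard frame of multipliers $\{h_n\}_n$ is the (adjointable) module morphism $\theta:E\to H_A$,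 $\theta(\xi)=(\langle h_n,\xi\rangle_{M(E)})_n$. A standard frame of multipliers $\{t_n\}_n$ in $E$ is a dual frame of multipliers of the standard frame of multipliers $\{h_n\}_n$ if for all $\xi\in E$ the series $\sum_nh_n\cdot\langle t_n,\xi\rangle_{M(E)}$ converges in $E$ and $\xi=\sum_nh_n\cdot\langle t_n,\xi\rangle_{M(E)}$. Two standard frames of multipliers are duals to each other if each is a dual frame of multipliers of the other. *)

theory Defs
  imports "HOL-Analysis.Analysis" "HOL-Library.Function_Algebras"
begin

section \<open>Complex vector spaces and families of seminorms\<close>

class complex_vector = ab_group_add +
  fixes scaleC :: "complex \<Rightarrow> 'a \<Rightarrow> 'a"  (infixr "*\<^sub>C" 75)
  assumes scaleC_add_right: "c *\<^sub>C (x + y) = c *\<^sub>C x + c *\<^sub>C y"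
    and scaleC_add_left: "(c + d) *\<^sub>C x = c *\<^sub>C x + d *\<^sub>C x"
    and scaleC_scaleC: "c *\<^sub>C d *\<^sub>C x = (c * d) *\<^sub>C x"
    and scaleC_one: "1 *\<^sub>C x = x"

text \<open>Together with the pointwise additive structure of \<^theory>\<open>HOL-Library.Function_Algebras\<close>
  this makes the sequences and the maps with values in a complex vector space complex vector
  spaces.\<close>

instantiation "fun" :: (type, complex_vector) complex_vector
begin

definition scaleC_fun :: "complex \<Rightarrow> ('a \<Rightarrow> 'b) \<Rightarrow> 'a \<Rightarrow> 'b"
  where "scaleC_fun c f = (\<lambda>x. c *\<^sub>C f x)"

instance
  by standard
    (simp_all add: scaleC_fun_def fun_eq_iff scaleC_add_right scaleC_add_left scaleC_scaleC scaleC_one)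

end

definition complex_subspace :: "'b::complex_vector set \<Rightarrow> bool"
  where "complex_subspace V \<longleftrightarrow>
    0 \<in> V \<and> (\<forall>x\<in>V. \<forall>y\<in>V. x + y \<in> V) \<and> (\<forall>c. \<forall>x\<in>V. c *\<^sub>C x \<in> V)"

definition (in ab_group_add) seminorm_topology :: "'a set \<Rightarrow> ('a \<Rightarrow> real) set \<Rightarrow> 'a topology"
  where "seminorm_topology V P =
    topology_generated_by {{y \<in> V. p (y - x) < e} | x p e. x \<in> V \<and> p \<in> P \<and> 0 < e}"

text \<open>Completeness of \<open>V\<close> for the uniform structure given by the seminorms in \<open>P\<close>; since these
  need not be countably many, it is stated with Cauchy filters and not with Cauchy sequences.\<close>

definition (in ab_group_add) seminorm_complete :: "'a set \<Rightarrow> ('a \<Rightarrow> real) set \<Rightarrow> bool"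
  where "seminorm_complete V P \<longleftrightarrow>
    (\<forall>F. F \<noteq> bot \<and> F \<le> principal V \<and>
         (\<forall>p\<in>P. \<forall>e>0. \<forall>\<^sub>F (x, y) in F \<times>\<^sub>F F. p (x - y) < e) \<longrightarrow>
         (\<exists>l. limitin (seminorm_topology V P) (\<lambda>x. x) l F))"


section \<open>Pro-C*-algebras\<close>

class complex_star_algebra = complex_vector + ring +
  fixes star :: "'a \<Rightarrow> 'a"
  assumes scaleC_mult_left: "(c *\<^sub>C x) * y = c *\<^sub>C (x * y)"
    and scaleC_mult_right: "x * (c *\<^sub>C y) = c *\<^sub>C (x * y)"
    and star_add: "star (x + y) = star x + star y"
    and star_scaleC: "star (c *\<^sub>C x) = cnj c *\<^sub>C star x"
    and star_mult: "star (x * y) = star y * star x"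
    and star_star: "star (star x) = x"

definition (in complex_star_algebra) cstar_seminorm :: "('a \<Rightarrow> real) \<Rightarrow> bool"
  where "cstar_seminorm p \<longleftrightarrow>
    (\<forall>x. 0 \<le> p x) \<and> (\<forall>x y. p (x + y) \<le> p x + p y) \<and> (\<forall>c x. p (c *\<^sub>C x) = cmod c * p x) \<and>
    (\<forall>x y. p (x * y) \<le> p x * p y) \<and> (\<forall>x. p (star x * x) = (p x)\<^sup>2)"

text \<open>Continuity of the algebraic operations needs no separate axiom: it holds for any topology
  given by C*-seminorms.\<close>

class pro_cstar_algebra = complex_star_algebra + t2_space +
  assumes cstar_topology:
    "\<exists>P. P \<noteq> {} \<and> (\<forall>p\<in>P. cstar_seminorm p) \<and>
       (\<forall>p\<in>P. \<forall>q\<in>P. \<exists>r\<in>P. \<forall>x. p x \<le> r x \<and> q x \<le> r x) \<and>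
       (\<forall>U. open U \<longleftrightarrow> openin (seminorm_topology UNIV P) U) \<and> seminorm_complete UNIV P"

definition continuous_cstar_seminorms :: "('a::pro_cstar_algebra \<Rightarrow> real) set"
  where "continuous_cstar_seminorms = {p. cstar_seminorm p \<and> continuous_on UNIV p}"

definition cstar_positive :: "'a::complex_star_algebra \<Rightarrow> bool"
  where "cstar_positive a \<longleftrightarrow> (\<exists>b. a = star b * b)"

definition cstar_le :: "'a::complex_star_algebra \<Rightarrow> 'a \<Rightarrow> bool"  (infix "\<le>\<^sub>A" 50)
  where "a \<le>\<^sub>A b \<longleftrightarrow> cstar_positive (b - a)"


section \<open>Hilbert modules\<close>

text \<open>The complex vector space structure of a module is that of the ambient type, restricted to
  the carrier.\<close>

record ('a, 'e) cmodule =
  carrier :: "'e set"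
  act :: "'e \<Rightarrow> 'a \<Rightarrow> 'e"
  ip :: "'e \<Rightarrow> 'e \<Rightarrow> 'a"

locale pre_hilbert_module =
  fixes E :: "('a::pro_cstar_algebra, 'e::complex_vector) cmodule"
  assumes subspace: "complex_subspace (carrier E)"
    and act_closed: "x \<in> carrier E \<Longrightarrow> act E x a \<in> carrier E"
    and act_add_left: "x \<in> carrier E \<Longrightarrow> y \<in> carrier E \<Longrightarrow> act E (x + y) a = act E x a + act E y a"
    and act_add_right: "x \<in> carrier E \<Longrightarrow> act E x (a + b) = act E x a + act E x b"
    and act_mult: "x \<in> carrier E \<Longrightarrow> act E x (a * b) = act E (act E x a) b"
    and act_scaleC_left: "x \<in> carrier E \<Longrightarrow> act E (c *\<^sub>C x) a = c *\<^sub>C act E x a"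
    and act_scaleC_right: "x \<in> carrier E \<Longrightarrow> act E x (c *\<^sub>C a) = c *\<^sub>C act E x a"
    and ip_add_right: "x \<in> carrier E \<Longrightarrow> y \<in> carrier E \<Longrightarrow> z \<in> carrier E \<Longrightarrow>
      ip E x (y + z) = ip E x y + ip E x z"
    and ip_scaleC_right: "x \<in> carrier E \<Longrightarrow> y \<in> carrier E \<Longrightarrow> ip E x (c *\<^sub>C y) = c *\<^sub>C ip E x y"
    and ip_act_right: "x \<in> carrier E \<Longrightarrow> y \<in> carrier E \<Longrightarrow> ip E x (act E y a) = ip E x y * a"
    and ip_star: "x \<in> carrier E \<Longrightarrow> y \<in> carrier E \<Longrightarrow> star (ip E x y) = ip E y x"
    and ip_positive: "x \<in> carrier E \<Longrightarrow> cstar_positive (ip E x x)"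
    and ip_definite: "x \<in> carrier E \<Longrightarrow> ip E x x = 0 \<longleftrightarrow> x = 0"

definition module_seminorm ::
    "('a, 'e) cmodule \<Rightarrow> ('a \<Rightarrow> real) \<Rightarrow> 'e \<Rightarrow> real"
  where "module_seminorm E p x = sqrt (p (ip E x x))"

definition module_seminorms ::
    "('a::pro_cstar_algebra, 'e) cmodule \<Rightarrow> ('e \<Rightarrow> real) set"
  where "module_seminorms E = module_seminorm E ` continuous_cstar_seminorms"

definition module_topology ::
    "('a::pro_cstar_algebra, 'e::complex_vector) cmodule \<Rightarrow> 'e topology"
  where "module_topology E = seminorm_topology (carrier E) (module_seminorms E)"

locale hilbert_module = pre_hilbert_module +
  assumes complete: "seminorm_complete (carrier E) (module_seminorms E)"

definition algebra_module :: "('a::pro_cstar_algebra, 'a) cmodule"  ("\<A>")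
  where "\<A> = \<lparr>carrier = UNIV, act = (\<lambda>a b. a * b), ip = (\<lambda>a b. star a * b)\<rparr>"

definition sequence_module :: "('a::pro_cstar_algebra, nat \<Rightarrow> 'a) cmodule"  ("\<H>\<^sub>A")
  where "\<H>\<^sub>A = \<lparr>carrier = {a. summable (\<lambda>n. star (a n) * a n)},
    act = (\<lambda>a b n. a n * b), ip = (\<lambda>a b. \<Sum>n. star (a n) * b n)\<rparr>"


section \<open>Adjointable module morphisms and multipliers\<close>

text \<open>Maps are extensional (\<open>undefined\<close> outside the carrier of their domain), so that equality of
  maps is equality on the carrier.\<close>

definition module_morphisms ::
    "('a, 'e::complex_vector) cmodule \<Rightarrow> ('a, 'f::complex_vector) cmodule \<Rightarrow> ('e \<Rightarrow> 'f) set"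
  where "module_morphisms E F = {T \<in> carrier E \<rightarrow>\<^sub>E carrier F.
    (\<forall>x\<in>carrier E. \<forall>y\<in>carrier E. T (x + y) = T x + T y) \<and>
    (\<forall>c. \<forall>x\<in>carrier E. T (c *\<^sub>C x) = c *\<^sub>C T x) \<and>
    (\<forall>x\<in>carrier E. \<forall>a. T (act E x a) = act F (T x) a)}"

definition is_module_adjoint ::
    "('a, 'e::complex_vector) cmodule \<Rightarrow> ('a, 'f::complex_vector) cmodule \<Rightarrow>
      ('e \<Rightarrow> 'f) \<Rightarrow> ('f \<Rightarrow> 'e) \<Rightarrow> bool"
  where "is_module_adjoint E F T S \<longleftrightarrow> S \<in> module_morphisms F E \<and>
    (\<forall>x\<in>carrier E. \<forall>y\<in>carrier F. ip F (T x) y = ip E x (S y))"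

definition adjointable ::
    "('a, 'e::complex_vector) cmodule \<Rightarrow> ('a, 'f::complex_vector) cmodule \<Rightarrow> ('e \<Rightarrow> 'f) set"
  where "adjointable E F = {T \<in> module_morphisms E F. \<exists>S. is_module_adjoint E F T S}"

definition module_adjoint ::
    "('a, 'e::complex_vector) cmodule \<Rightarrow> ('a, 'f::complex_vector) cmodule \<Rightarrow>
      ('e \<Rightarrow> 'f) \<Rightarrow> 'f \<Rightarrow> 'e"
  where "module_adjoint E F T = (THE S. is_module_adjoint E F T S)"

definition operator_seminorm ::
    "('a, 'e) cmodule \<Rightarrow> ('a, 'f) cmodule \<Rightarrow> ('a \<Rightarrow> real) \<Rightarrow> ('e \<Rightarrow> 'f) \<Rightarrow> real"
  where "operator_seminorm E F p T =
    Sup {module_seminorm F p (T x) | x. x \<in> carrier E \<and> module_seminorm E p x \<le> 1}"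

definition multipliers ::
    "('a::pro_cstar_algebra, 'e::complex_vector) cmodule \<Rightarrow> ('a \<Rightarrow> 'e) set"
  where "multipliers E = adjointable \<A> E"

definition multiplier_topology ::
    "('a::pro_cstar_algebra, 'e::complex_vector) cmodule \<Rightarrow> ('a \<Rightarrow> 'e) topology"
  where "multiplier_topology E =
    seminorm_topology (multipliers E) (operator_seminorm \<A> E ` continuous_cstar_seminorms)"

text \<open>The canonical embedding of a Hilbert module into its multiplier module.\<close>

definition embed :: "('a, 'e) cmodule \<Rightarrow> 'e \<Rightarrow> 'a \<Rightarrow> 'e"
  where "embed E x = (\<lambda>a. act E x a)"

text \<open>The inner product of a multiplier \<open>g\<close> and a module element \<open>x\<close> (in this order), identified
  with an element of the algebra; the inner product in the reverse order is its \<open>star\<close>.\<close>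

definition multiplier_ip ::
    "('a::pro_cstar_algebra, 'e::complex_vector) cmodule \<Rightarrow> ('a \<Rightarrow> 'e) \<Rightarrow> 'e \<Rightarrow> 'a"
  where "multiplier_ip E g x = module_adjoint \<A> E g x"

text \<open>The multiplier module is a module over the multiplier algebra \<open>multipliers \<A>\<close>, acting by
  composition.\<close>

definition multiplier_submodule ::
    "('a::pro_cstar_algebra, 'e::complex_vector) cmodule \<Rightarrow> ('a \<Rightarrow> 'e) set \<Rightarrow> bool"
  where "multiplier_submodule E X \<longleftrightarrow> X \<subseteq> multipliers E \<and> complex_subspace X \<and>
    (\<forall>T\<in>X. \<forall>S\<in>multipliers \<A>. T \<circ> S \<in> X)"

definition closed_submodule_generated ::
    "('a::pro_cstar_algebra, 'e::complex_vector) cmodule \<Rightarrow> ('a \<Rightarrow> 'e) set \<Rightarrow> ('a \<Rightarrow> 'e) set"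
  where "closed_submodule_generated E G =
    \<Inter>{X. multiplier_submodule E X \<and> closedin (multiplier_topology E) X \<and> G \<subseteq> X}"

definition countably_generated_in_multipliers ::
    "('a::pro_cstar_algebra, 'e::complex_vector) cmodule \<Rightarrow> bool"
  where "countably_generated_in_multipliers E \<longleftrightarrow>
    (\<exists>g :: nat \<Rightarrow> 'a \<Rightarrow> 'e. (\<forall>n. g n \<in> multipliers E) \<and>
       closed_submodule_generated E {embed E (g n a) | n a. True} = embed E ` carrier E)"


section \<open>Standard frames of multipliers\<close>

definition standard_frame ::
    "('a::pro_cstar_algebra, 'e::complex_vector) cmodule \<Rightarrow> (nat \<Rightarrow> 'a \<Rightarrow> 'e) \<Rightarrow> bool"
  where "standard_frame E h \<longleftrightarrow>
    (\<forall>n. h n \<in> multipliers E) \<and>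
    (\<forall>x\<in>carrier E. summable (\<lambda>n. star (multiplier_ip E (h n) x) * multiplier_ip E (h n) x)) \<and>
    (\<exists>C D :: real. 0 < C \<and> 0 < D \<and> (\<forall>x\<in>carrier E.
       complex_of_real C *\<^sub>C ip E x x
         \<le>\<^sub>A (\<Sum>n. star (multiplier_ip E (h n) x) * multiplier_ip E (h n) x) \<and>
       (\<Sum>n. star (multiplier_ip E (h n) x) * multiplier_ip E (h n) x)
         \<le>\<^sub>A complex_of_real D *\<^sub>C ip E x x))"

definition frame_transform ::
    "('a::pro_cstar_algebra, 'e::complex_vector) cmodule \<Rightarrow> (nat \<Rightarrow> 'a \<Rightarrow> 'e) \<Rightarrow> 'e \<Rightarrow> nat \<Rightarrow> 'a"
  where "frame_transform E h = (\<lambda>x\<in>carrier E. \<lambda>n. multiplier_ip E (h n) x)"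

definition dual_frame ::
    "('a::pro_cstar_algebra, 'e::complex_vector) cmodule \<Rightarrow>
      (nat \<Rightarrow> 'a \<Rightarrow> 'e) \<Rightarrow> (nat \<Rightarrow> 'a \<Rightarrow> 'e) \<Rightarrow> bool"
  where "dual_frame E h t \<longleftrightarrow> standard_frame E h \<and> standard_frame E t \<and>
    (\<forall>x\<in>carrier E.
       limitin (module_topology E) (\<lambda>N. \<Sum>n<N. h n (multiplier_ip E (t n) x)) x sequentially)"

definition duals_to_each_other ::
    "('a::pro_cstar_algebra, 'e::complex_vector) cmodule \<Rightarrow>
      (nat \<Rightarrow> 'a \<Rightarrow> 'e) \<Rightarrow> (nat \<Rightarrow> 'a \<Rightarrow> 'e) \<Rightarrow> bool"
  where "duals_to_each_other E h t \<longleftrightarrow> dual_frame E h t \<and> dual_frame E t h"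

end

(* For one multiplier frame h with frame transform \<theta>, the adjoint of \<theta> is the synthesis operator
   a \<mapsto> \<Sum>n. h n (a n). The series converges because, with u a partial sum over I, Cauchy-Schwarz for
   finite sums and the upper frame bound D give
     p(<u,u>)^2 = p(\<Sum>n\<in>I. <h_n,u>^* a_n)^2 \<le> D p(<u,u>) p(\<Sum>n\<in>I. a_n^* a_n).
   Hence \<theta>1^* \<theta>2 = id says that t is a dual of h, and taking adjoints this is symmetric in h and t.

   Cauchy-Schwarz and the monotonicity of p on positive elements rest on the positivity of c^* c in a
   C*-algebra. Completeness of the quotient by the kernel of p is avoided: everything is done for a
   C*-seminorm p on a unital *-algebra, with positivity of h defined by p(t 1 - h) \<le> t and with
   square roots up to an arbitrarily small error. *)

theory Submission
  imports Defs
begin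

section \<open>Complex vector spaces and C*-seminorms\<close>

text \<open>The order in the frame inequalities is given by factorizations
  \<open>star b * b\<close>. From these it is not visible that sums of positive elements are
  positive or that \<open>p\<close> is monotone, and with the quotient avoided no spectrum or
  functional calculus is at hand. Two substitutes carry the argument. First, the iteration y(n+1) =
  (x + y(n)^2) / 2 with x = 1 - h satisfies (1 - y(n))^2 - h = 2 (y(n+1) - y(n)): the error of a
  root is an increment, and increments become small without any limit being formed. Second, for
  commuting self-adjoint k and w the C*-identity of k + i w gives p(w)^2 <= p(k^2 + w^2), which
  replaces the spectral comparison of w^2 with k^2 + w^2. The price of approximate roots is that the
  Kelley-Vaught contradiction becomes an inequality: an almost negative square with \<alpha> =
  p(z)^2 satisfies 2 \<alpha>^4 <= \<alpha>^4 + O(e). As the algebra need not have a unit,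
  positivity is tested in a unitization, whose seminorm must again satisfy the C*-identity.\<close>

abbreviation scaleRC :: "real \<Rightarrow> 'a::complex_vector \<Rightarrow> 'a"  (infixr "*\<^sub>r" 75)
  where "t *\<^sub>r x \<equiv> complex_of_real t *\<^sub>C x"

lemma scaleC_zero_left [simp]: "0 *\<^sub>C (x::'a::complex_vector) = 0"
proof -
  have "0 *\<^sub>C x + 0 *\<^sub>C x = 0 *\<^sub>C x + 0"
    by (simp flip: scaleC_add_left)
  then show ?thesis by (simp only: add_left_cancel)
qed

lemma scaleC_zero_right [simp]: "c *\<^sub>C (0::'a::complex_vector) = 0"
proof -
  have "c *\<^sub>C (0::'a) + c *\<^sub>C 0 = c *\<^sub>C 0 + 0"
    by (simp flip: scaleC_add_right)
  then show ?thesis by (simp only: add_left_cancel)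
qed

lemma scaleC_minus_left [simp]: "(- c) *\<^sub>C (x::'a::complex_vector) = - (c *\<^sub>C x)"
proof (rule minus_unique [symmetric])
  show "c *\<^sub>C x + (- c) *\<^sub>C x = 0"
    by (simp flip: scaleC_add_left)
qed

lemma scaleC_minus_right [simp]: "c *\<^sub>C (- (x::'a::complex_vector)) = - (c *\<^sub>C x)"
proof (rule minus_unique [symmetric])
  show "c *\<^sub>C x + c *\<^sub>C (- x) = 0"
    by (simp flip: scaleC_add_right)
qed

lemma scaleC_diff_right: "c *\<^sub>C (x - y) = c *\<^sub>C x - c *\<^sub>C (y::'a::complex_vector)"
  using scaleC_add_right [of c x "- y"] by simp

lemma scaleC_diff_left: "(c - d) *\<^sub>C x = c *\<^sub>C x - d *\<^sub>C (x::'a::complex_vector)"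
  using scaleC_add_left [of c "- d" x] by simp

lemma scaleC_sum_right: "c *\<^sub>C (\<Sum>i\<in>I. f i) = (\<Sum>i\<in>I. c *\<^sub>C (f i :: 'a::complex_vector))"
  by (induction I rule: infinite_finite_induct) (simp_all add: scaleC_add_right)

lemmas scaleC_linear = scaleC_add_right scaleC_add_left scaleC_diff_right scaleC_diff_left
  scaleC_scaleC scaleC_one

lemma star_zero [simp]: "star (0::'a::complex_star_algebra) = 0"
  using star_add [of "0::'a" 0] by simp

lemma star_minus [simp]: "star (- (x::'a::complex_star_algebra)) = - star x"
  by (rule minus_unique [symmetric]) (simp flip: star_add)

lemma star_diff: "star (x - (y::'a::complex_star_algebra)) = star x - star y"
  using star_add [of x "- y"] by simp

lemma star_sum: "star (\<Sum>i\<in>I. f i) = (\<Sum>i\<in>I. star (f i :: 'a::complex_star_algebra))"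
  by (induction I rule: infinite_finite_induct) (simp_all add: star_add)

lemma star_one [simp]: "star (1::'a::{complex_star_algebra,ring_1}) = 1"
  using star_mult [of "star (1::'a)" 1] by (simp add: star_star)

lemmas star_simps = star_add star_diff star_mult star_scaleC star_star star_minus

section \<open>C*-seminorms and commuting self-adjoint pairs\<close>

locale cstar_seminormed =
  fixes p :: "'b::complex_star_algebra \<Rightarrow> real"
  assumes cstar_seminorm: "cstar_seminorm p"
begin

lemma nonneg [simp]: "0 \<le> p x"
  and triangle: "p (x + y) \<le> p x + p y"
  and scaleC: "p (c *\<^sub>C x) = cmod c * p x"
  and submult: "p (x * y) \<le> p x * p y"
  and cstar: "p (star x * x) = (p x)\<^sup>2"
  using cstar_seminorm unfolding cstar_seminorm_def by blast+

lemma zero [simp]: "p 0 = 0"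
  using scaleC [of 0 0] by simp

lemma minus [simp]: "p (- x) = p x"
  using scaleC [of "- 1" x] by (simp add: scaleC_one)

lemma commute: "p (x - y) = p (y - x)"
  using minus [of "x - y"] by simp

lemma triangle_diff: "p (x - y) \<le> p x + p y"
  using triangle [of x "- y"] by simp

lemma le_via: "p x \<le> p y + p (x - y)"
  using triangle [of y "x - y"] by simp

lemma star: "p (star x) = p x"
proof -
  have le: "p y \<le> p (star y)" for y
  proof (cases "p y = 0")
    case False
    have "p y * p y \<le> p (star y) * p y"
      using submult [of "star y" y] by (simp add: cstar power2_eq_square)
    with False show ?thesis using nonneg [of y] by (simp add: mult_le_cancel_right)
  qed simp
  from le [of x] le [of "star x"] show ?thesis by (simp add: star_star)
qed

lemma selfadjoint_square: "star x = x \<Longrightarrow> p (x * x) = (p x)\<^sup>2"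
  using cstar [of x] by simp

lemma submult_le: "p x \<le> a \<Longrightarrow> p y \<le> b \<Longrightarrow> p (x * y) \<le> a * b"
  by (rule order_trans [OF submult]) (auto intro: mult_mono order_trans [OF nonneg])

text \<open>A pair of commuting self-adjoint elements \<open>k\<close>, \<open>w\<close> is handled through the normal element
  \<open>k + i w\<close>, of which \<open>w\<close> is the imaginary part.\<close>

lemma commuting_squares:
  assumes "star w = w" "star k = k" "k * w = w * k"
  shows "(p w)\<^sup>2 \<le> p (k * k + w * w)"
proof -
  let ?u = "k + \<i> *\<^sub>C w"
  have "star ?u * ?u = k * k + w * w"
    using assms by (simp add: star_simps scaleC_mult_left scaleC_mult_right scaleC_linear algebra_simps)
  then have u: "(p ?u)\<^sup>2 = p (k * k + w * w)"
    by (metis cstar)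
  have "2 *\<^sub>r (\<i> *\<^sub>C w) = ?u - star ?u"
    using assms scaleC_add_left [of 1 1 "\<i> *\<^sub>C w"] by (simp add: star_simps scaleC_one)
  then have "p (2 *\<^sub>r (\<i> *\<^sub>C w)) \<le> p ?u + p (star ?u)"
    by (simp add: triangle_diff)
  then have "p w \<le> p ?u"
    by (simp add: scaleC star)
  then show ?thesis
    using u by (metis nonneg power_mono)
qed

end

text \<open>With \<open>x = 1 - h\<close> this is the classical iteration towards \<open>1 - sqrt h\<close>.\<close>

primrec sqrt_iteration :: "'b::{complex_star_algebra,ring_1} \<Rightarrow> nat \<Rightarrow> 'b"
  where "sqrt_iteration x 0 = 0"
  | "sqrt_iteration x (Suc n) = (1/2) *\<^sub>r (x + sqrt_iteration x n * sqrt_iteration x n)"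

text \<open>The scalar iteration at x = 1. As the recursion has nonnegative coefficients, it
  dominates the norms and the increments of \<open>sqrt_iteration x\<close> whenever
  \<open>p x\<close> is at most 1.\<close>

primrec sqrt_majorant :: "nat \<Rightarrow> real"
  where "sqrt_majorant 0 = 0"
  | "sqrt_majorant (Suc n) = (1 + (sqrt_majorant n)\<^sup>2) / 2"

lemma sqrt_majorant_bounds: "0 \<le> sqrt_majorant n \<and> sqrt_majorant n \<le> 1"
  by (induction n) (auto simp: power_le_one)

text \<open>The sequence increases because 2 s <= 1 + s^2 and is bounded by 1, so it
  converges.\<close>

lemma sqrt_majorant_increments: "(\<lambda>n. sqrt_majorant (Suc n) - sqrt_majorant n) \<longlonglongrightarrow> 0"
proof -
  have "incseq sqrt_majorant"
  proof (rule incseq_SucI)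
    fix n
    show "sqrt_majorant n \<le> sqrt_majorant (Suc n)"
      using sum_squares_bound [of 1 "sqrt_majorant n"] by simp
  qed
  moreover have "bdd_above (range sqrt_majorant)"
    using sqrt_majorant_bounds by (intro bdd_aboveI [of _ 1]) auto
  ultimately obtain L where L: "sqrt_majorant \<longlonglongrightarrow> L"
    using LIMSEQ_incseq_SUP by blast
  from tendsto_diff [OF LIMSEQ_Suc [OF L] L] show ?thesis by simp
qed

text \<open>Each iterate is a polynomial in \<open>x\<close>.\<close>

lemma sqrt_iteration_commute: "y * x = x * y \<Longrightarrow> y * sqrt_iteration x n = sqrt_iteration x n * y"
proof (induction n)
  case (Suc n)
  let ?s = "sqrt_iteration x n"
  have "y * (?s * ?s) = ?s * y * ?s"
    using Suc by (simp add: mult.assoc [symmetric])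
  also have "\<dots> = ?s * ?s * y"
    using Suc by (simp add: mult.assoc)
  finally show ?case
    using Suc by (simp add: scaleC_mult_left scaleC_mult_right distrib_left distrib_right)
qed simp

section \<open>Approximate square roots and the positive cone of a unital C*-seminorm\<close>

locale unital_cstar_seminormed = cstar_seminormed p
  for p :: "'b::{complex_star_algebra,ring_1} \<Rightarrow> real"
begin

text \<open>The C*-identity gives p(1) = p(1)^2, so the value is 0 or 1; it is 0 for the zero
  seminorm.\<close>

lemma one_le: "p 1 \<le> 1"
proof -
  have "p 1 * p 1 = p 1" using cstar [of 1] by (simp add: power2_eq_square)
  then show ?thesis by (cases "p 1 = 0") auto
qed

lemma scale_one_le: "0 \<le> t \<Longrightarrow> p (t *\<^sub>r 1) \<le> t"
  using one_le mult_left_mono [of "p 1" 1 t] by (simp add: scaleC)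

lemma sqrt_iteration_le:
  assumes "p x \<le> 1"
  shows "p (sqrt_iteration x n) \<le> sqrt_majorant n"
proof (induction n)
  case (Suc n)
  have "p (x + sqrt_iteration x n * sqrt_iteration x n) \<le> 1 + sqrt_majorant n * sqrt_majorant n"
    by (intro order_trans [OF triangle] add_mono assms submult_le Suc)
  then show ?case by (simp add: scaleC power2_eq_square)
qed simp

text \<open>Consecutive iterates y and y' commute, so y'^2 - y^2 = (y' + y) (y' - y). The majorant
  obeys the corresponding recursion with equality, and the bound passes to the next index.\<close>

lemma sqrt_iteration_increment_le:
  assumes "p x \<le> 1"
  shows "p (sqrt_iteration x (Suc n) - sqrt_iteration x n) \<le> sqrt_majorant (Suc n) - sqrt_majorant n"
proof (induction n)
  case 0
  then show ?case using assms by (simp add: scaleC)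
next
  case (Suc n)
  let ?y = "sqrt_iteration x n" and ?y' = "sqrt_iteration x (Suc n)"
  have comm: "?y * ?y' = ?y' * ?y"
    by (rule sqrt_iteration_commute) (simp add: sqrt_iteration_commute [of x x n])
  have "sqrt_iteration x (Suc (Suc n)) - ?y' =
      (1/2) *\<^sub>r (x + ?y' * ?y') - (1/2) *\<^sub>r (x + ?y * ?y)"
    by (simp only: sqrt_iteration.simps)
  also have "\<dots> = (1/2) *\<^sub>r ((?y' + ?y) * (?y' - ?y))"
    by (simp only: scaleC_diff_right [symmetric])
       (simp add: comm distrib_right right_diff_distrib del: sqrt_iteration.simps)
  finally have eq: "sqrt_iteration x (Suc (Suc n)) - ?y' = (1/2) *\<^sub>r ((?y' + ?y) * (?y' - ?y))" .
  have "p ((?y' + ?y) * (?y' - ?y)) \<le>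
      (sqrt_majorant (Suc n) + sqrt_majorant n) * (sqrt_majorant (Suc n) - sqrt_majorant n)"
    by (intro submult_le order_trans [OF triangle] add_mono sqrt_iteration_le assms Suc)
  moreover have "(sqrt_majorant (Suc n) + sqrt_majorant n) * (sqrt_majorant (Suc n) - sqrt_majorant n) =
      2 * (sqrt_majorant (Suc (Suc n)) - sqrt_majorant (Suc n))"
    by (simp add: sqrt_majorant.simps(2) [of "Suc n"] power2_eq_square algebra_simps del: sqrt_majorant.simps)
       (simp add: power2_eq_square algebra_simps)
  ultimately show ?case
    unfolding eq scaleC by (simp del: sqrt_majorant.simps sqrt_iteration.simps)
qed

text \<open>The root is w = 1 - y(n). Its distance to 1 makes it positive, and the commutation
  clause stands in for w being a function of h. The error is twice an increment, whence
  \<open>e / 2\<close> below.\<close>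

lemma approx_sqrt_near_one:
  assumes h: "star h = h" "p (1 - h) \<le> 1" and e: "0 < e"
  obtains w where "star w = w" "p (1 - w) \<le> 1" "p (w * w - h) \<le> e"
    "\<And>y. y * h = h * y \<Longrightarrow> y * w = w * y"
proof -
  let ?y = "sqrt_iteration (1 - h)"
  from sqrt_majorant_increments e obtain n
    where n: "sqrt_majorant (Suc n) - sqrt_majorant n < e / 2"
    using order_tendstoD(2) [of _ 0 sequentially "e / 2"]
    by (metis (no_types, lifting) eventually_sequentially half_gt_zero order_refl)
  have sa: "star (?y k) = ?y k" for k
    by (induction k) (simp_all add: star_simps h)
  have "(1 - ?y n) * (1 - ?y n) - h = 2 *\<^sub>r (?y (Suc n) - ?y n)"
    using scaleC_add_left [of 1 1 "?y n"]
    by (simp add: scaleC_linear algebra_simps)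
  then have "p ((1 - ?y n) * (1 - ?y n) - h) = 2 * p (?y (Suc n) - ?y n)"
    by (simp only: scaleC) simp
  also have "\<dots> \<le> e"
    using sqrt_iteration_increment_le [OF h(2), of n] n by linarith
  finally have "p ((1 - ?y n) * (1 - ?y n) - h) \<le> e" .
  moreover have "p (1 - (1 - ?y n)) \<le> 1"
    using sqrt_iteration_le [OF h(2), of n] sqrt_majorant_bounds [of n] by simp
  moreover have "y * (1 - ?y n) = (1 - ?y n) * y" if "y * h = h * y" for y
    using sqrt_iteration_commute [of y "1 - h" n] that by (simp add: algebra_simps)
  moreover have "star (1 - ?y n) = 1 - ?y n"
    by (simp add: star_simps sa)
  ultimately show thesis
    by (intro that)
qed

text \<open>An approximate root w of 1 - k^2 commutes with k, and k^2 + w^2 is close to 1;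
  \<open>commuting_squares\<close> then bounds p(w)^2 by about 1. In spectral terms this is 0 <= 1 -
  k^2 <= 1.\<close>

lemma one_minus_square_le:
  assumes k: "star k = k" "p k \<le> 1"
  shows "p (1 - k * k) \<le> 1"
proof (rule field_le_epsilon)
  fix e :: real
  assume "0 < e"
  have "p (1 - (1 - k * k)) \<le> 1"
    using submult_le [OF k(2) k(2)] by simp
  moreover have "star (1 - k * k) = 1 - k * k" "0 < e / 2"
    using \<open>0 < e\<close> by (simp_all add: star_simps k)
  ultimately obtain w where w: "star w = w" "p (w * w - (1 - k * k)) \<le> e / 2"
    and comm: "\<And>y. y * (1 - k * k) = (1 - k * k) * y \<Longrightarrow> y * w = w * y"
    using approx_sqrt_near_one by metis
  have "k * w = w * k"
    by (rule comm) (simp add: algebra_simps)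
  then have "(p w)\<^sup>2 \<le> p (k * k + w * w)"
    by (intro commuting_squares w k)
  also have "\<dots> \<le> p 1 + p (w * w - (1 - k * k))"
    using le_via [of "k * k + w * w" 1] by (simp add: algebra_simps)
  finally have "p (w * w) \<le> 1 + e / 2"
    using w one_le by (simp add: selfadjoint_square)
  then show "p (1 - k * k) \<le> 1 + e"
    using le_via [of "1 - k * k" "w * w"] commute [of "w * w" "1 - k * k"] w by simp
qed

text \<open>In a C*-algebra the bound says that the spectrum lies in [0, 2t]. In this form sums only
  cost the triangle inequality, whereas the positivity of squares has to be proved.\<close>

definition pos :: "'b \<Rightarrow> bool"
  where "pos h \<longleftrightarrow> star h = h \<and> (\<exists>t\<ge>0. p (t *\<^sub>r 1 - h) \<le> t)"

lemma posI: "star h = h \<Longrightarrow> p (t *\<^sub>r 1 - h) \<le> t \<Longrightarrow> pos h"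
  unfolding pos_def using nonneg order_trans by blast

lemma pos_selfadjoint: "pos h \<Longrightarrow> star h = h"
  by (simp add: pos_def)

lemma pos_add:
  assumes "pos h" "pos k"
  shows "pos (h + k)"
proof -
  from assms obtain s t where "p (s *\<^sub>r 1 - h) \<le> s" "p (t *\<^sub>r 1 - k) \<le> t"
    unfolding pos_def by blast
  then have "p ((s + t) *\<^sub>r 1 - (h + k)) \<le> s + t"
    using triangle [of "s *\<^sub>r 1 - h" "t *\<^sub>r 1 - k"] by (simp add: scaleC_linear algebra_simps)
  with assms show ?thesis
    by (intro posI [of _ "s + t"]) (auto simp: star_simps pos_selfadjoint)
qed

lemma pos_scale:
  assumes "pos h" "0 \<le> r"
  shows "pos (r *\<^sub>r h)"
proof -
  from assms obtain t where "p (t *\<^sub>r 1 - h) \<le> t"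
    unfolding pos_def by blast
  then have "p (r *\<^sub>r (t *\<^sub>r 1 - h)) \<le> r * t"
    using assms by (simp add: scaleC mult_left_mono)
  with assms show ?thesis
    by (intro posI [of _ "r * t"]) (auto simp: star_simps pos_selfadjoint scaleC_linear)
qed

lemma pos_square:
  assumes "star k = k"
  shows "pos (k * k)"
proof -
  \<comment> \<open>The added 1 keeps s nonzero when \<open>p k = 0\<close>.\<close>
  define s where "s = p k + 1"
  have s: "0 < s" "p k \<le> s" by (simp_all add: s_def add_nonneg_pos)
  have "p (1 - (1/s) *\<^sub>r k * (1/s) *\<^sub>r k) \<le> 1"
    using s by (intro one_minus_square_le) (simp_all add: star_simps assms scaleC norm_divide)
  then have "p ((s\<^sup>2) *\<^sub>r (1 - (1/s) *\<^sub>r k * (1/s) *\<^sub>r k)) \<le> s\<^sup>2"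
    by (simp add: scaleC norm_power mult_left_le)
  moreover have "(s\<^sup>2) *\<^sub>r (1 - (1/s) *\<^sub>r k * (1/s) *\<^sub>r k) = (s\<^sup>2) *\<^sub>r 1 - k * k"
    using s by (simp add: scaleC_linear scaleC_mult_left scaleC_mult_right power2_eq_square)
  ultimately show ?thesis
    by (intro posI [of _ "s\<^sup>2"]) (simp_all add: star_simps assms)
qed

text \<open>Dividing by t brings h within distance 1 of the unit, where the iteration applies; the
  root is scaled back by \<open>sqrt t\<close>. The witness is enlarged by 1 so that it can be
  divided by.\<close>

lemma approx_sqrt:
  assumes h: "pos h" and e: "0 < e"
  obtains w where "pos w" "p (w * w - h) \<le> e" "\<And>y. y * h = h * y \<Longrightarrow> y * w = w * y"
proof -
  from h obtain t0 where t0: "p (t0 *\<^sub>r 1 - h) \<le> t0" "0 \<le> t0" and sa: "star h = h"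
    unfolding pos_def by blast
  define t where "t = t0 + 1"
  have t: "0 < t" using t0 by (simp add: t_def)
  have "p (t *\<^sub>r 1 - h) \<le> p (t0 *\<^sub>r 1 - h) + p 1"
    using triangle [of "t0 *\<^sub>r 1 - h" 1] by (simp add: t_def scaleC_linear algebra_simps)
  then have th: "p (t *\<^sub>r 1 - h) \<le> t"
    using t0 one_le by (simp add: t_def)
  have "p (1 - (1/t) *\<^sub>r h) = p ((1/t) *\<^sub>r (t *\<^sub>r 1 - h))"
    using t by (simp add: scaleC_linear)
  also have "\<dots> \<le> 1"
    using t th by (simp add: scaleC norm_divide)
  finally have "p (1 - (1/t) *\<^sub>r h) \<le> 1" .
  moreover have "0 < e / t" using e t by simp
  moreover have "star ((1/t) *\<^sub>r h) = (1/t) *\<^sub>r h" by (simp add: star_simps sa)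
  ultimately obtain w where w: "star w = w" "p (1 - w) \<le> 1" "p (w * w - (1/t) *\<^sub>r h) \<le> e / t"
    and comm: "\<And>y. y * (1/t) *\<^sub>r h = (1/t) *\<^sub>r h * y \<Longrightarrow> y * w = w * y"
    using approx_sqrt_near_one by metis
  have "pos w"
    using w by (intro posI [of _ 1]) (simp_all add: scaleC_one)
  then have "pos (sqrt t *\<^sub>r w)"
    using t by (intro pos_scale) simp_all
  moreover have "(sqrt t *\<^sub>r w) * (sqrt t *\<^sub>r w) - h = t *\<^sub>r (w * w - (1/t) *\<^sub>r h)"
    using t by (simp add: scaleC_mult_left scaleC_mult_right scaleC_linear flip: of_real_mult)
  then have "p ((sqrt t *\<^sub>r w) * (sqrt t *\<^sub>r w) - h) \<le> e"
    using t w(3) by (simp add: scaleC field_simps)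
  moreover have "y * (sqrt t *\<^sub>r w) = (sqrt t *\<^sub>r w) * y" if "y * h = h * y" for y
    using comm [of y] that by (simp add: scaleC_mult_left scaleC_mult_right)
  ultimately show thesis by (rule that)
qed

text \<open>For w^2 close to h and r = sqrt (s + e'), the norm of w / r is at most 1;
  \<open>one_minus_square_le\<close> applies and r^2 scales back. The witness in \<open>pos\<close>
  thus becomes any bound of the norm.\<close>

lemma pos_norm_bound:
  assumes h: "pos h" and s: "p h \<le> s"
  shows "p (s *\<^sub>r 1 - h) \<le> s"
proof (rule field_le_epsilon)
  fix e :: real
  assume "0 < e"
  \<comment> \<open>One third each for enlarging s to s + e', for replacing h by w^2, and for
    removing the multiple e' of the unit again.\<close>
  define e' where "e' = e / 3"
  have e': "0 < e'" using \<open>0 < e\<close> by (simp add: e'_def)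
  obtain w where w: "pos w" "p (w * w - h) \<le> e'"
    using approx_sqrt [OF h e'] by metis
  note sa = pos_selfadjoint [OF w(1)]
  define r where "r = sqrt (s + e')"
  have "0 \<le> s" using s nonneg order_trans by blast
  then have r: "0 < r" "r * r = s + e'" using e' by (simp_all add: r_def)
  have "(p w)\<^sup>2 \<le> s + e'"
    using le_via [of "w * w" h] w s by (simp add: selfadjoint_square [OF sa, symmetric])
  then have "p w \<le> r"
    unfolding r_def by (rule real_le_rsqrt)
  then have "p (1 - (1/r) *\<^sub>r w * (1/r) *\<^sub>r w) \<le> 1"
    using r by (intro one_minus_square_le) (simp_all add: star_simps sa scaleC norm_divide)
  then have "p ((r * r) *\<^sub>r (1 - (1/r) *\<^sub>r w * (1/r) *\<^sub>r w)) \<le> r * r"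
    by (simp only: scaleC) (simp add: norm_mult mult_left_le abs_mult)
  moreover have "(r * r) *\<^sub>r (1 - (1/r) *\<^sub>r w * (1/r) *\<^sub>r w) = (r * r) *\<^sub>r 1 - w * w"
    using r(1) by (simp add: scaleC_linear scaleC_mult_left scaleC_mult_right)
  ultimately have rw: "p ((s + e') *\<^sub>r 1 - w * w) \<le> s + e'"
    by (simp add: r)
  have "s *\<^sub>r 1 - h = ((s + e') *\<^sub>r 1 - w * w) + (w * w - h) - e' *\<^sub>r 1"
    by (simp add: scaleC_linear)
  then have "p (s *\<^sub>r 1 - h) \<le> p ((s + e') *\<^sub>r 1 - w * w) + p (w * w - h) + p (e' *\<^sub>r 1)"
    by (metis add_mono_thms_linordered_semiring(3) order_trans triangle triangle_diff)
  also have "\<dots> \<le> (s + e') + e' + e'"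
    using e' by (intro add_mono rw w scale_one_le) simp
  finally show "p (s *\<^sub>r 1 - h) \<le> s + e" by (simp add: e'_def)
qed

text \<open>Approximants within distance 1 have norm at most p(h) + 1, so by
  \<open>pos_norm_bound\<close> they share this witness, and h inherits it.\<close>

lemma pos_closed:
  assumes h: "star h = h" and approx: "\<And>e. 0 < e \<Longrightarrow> \<exists>g. pos g \<and> p (g - h) \<le> e"
  shows "pos h"
proof (rule posI [OF h])
  show "p ((p h + 1) *\<^sub>r 1 - h) \<le> p h + 1"
  proof (rule field_le_epsilon)
    fix e :: real
    assume "0 < e"
    then obtain g where g: "pos g" "p (g - h) \<le> min e 1"
      using approx [of "min e 1"] by auto
    then have "p ((p h + 1) *\<^sub>r 1 - g) \<le> p h + 1"
      using le_via [of g h] by (intro pos_norm_bound) auto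
    then show "p ((p h + 1) *\<^sub>r 1 - h) \<le> p h + 1 + e"
      using g triangle [of "(p h + 1) *\<^sub>r 1 - g" "g - h"] by simp
  qed
qed

text \<open>With approximate roots w of h and k of 1 - h, the sum k^2 + w^2 is close to 1, and
  \<open>commuting_squares\<close> applies.\<close>

lemma pos_contraction:
  assumes h: "pos h" and h': "pos (1 - h)"
  shows "p h \<le> 1"
proof (rule field_le_epsilon)
  fix e :: real
  assume "0 < e"
  then have e: "0 < e / 3" by simp
  obtain w where w: "pos w" "p (w * w - h) \<le> e / 3"
    and wc: "\<And>y. y * h = h * y \<Longrightarrow> y * w = w * y"
    using approx_sqrt [OF h e] by metis
  obtain k where k: "pos k" "p (k * k - (1 - h)) \<le> e / 3"
    and kc: "\<And>y. y * (1 - h) = (1 - h) * y \<Longrightarrow> y * k = k * y"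
    using approx_sqrt [OF h' e] by metis
  \<comment> \<open>w commutes with h, hence with 1 - h, hence with the root k of 1 - h.\<close>
  have "h * w = w * h" by (rule wc) simp
  then have "k * w = w * k" by (intro kc [symmetric]) (simp add: algebra_simps)
  then have "p (w * w) \<le> p (k * k + w * w)"
    using commuting_squares [of w k] w k by (simp add: pos_selfadjoint selfadjoint_square)
  also have "\<dots> \<le> p 1 + p ((k * k - (1 - h)) + (w * w - h))"
    using le_via [of "k * k + w * w" 1] by (simp add: algebra_simps)
  also have "\<dots> \<le> 1 + (e / 3 + e / 3)"
    by (intro add_mono order_trans [OF triangle] w k one_le)
  finally show "p h \<le> 1 + e"
    using le_via [of h "w * w"] commute [of "w * w" h] w by simp
qed

text \<open>For s slightly above p(h + k), both s 1 - (h + k) and k are positive, hence so is s 1 -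
  h; division by s leads to \<open>pos_contraction\<close>.\<close>

lemma pos_mono:
  assumes h: "pos h" and k: "pos k"
  shows "p h \<le> p (h + k)"
proof (rule field_le_epsilon)
  fix e :: real
  assume "0 < e"
  define s where "s = p (h + k) + e"
  have s: "0 < s" "p (h + k) \<le> s" using \<open>0 < e\<close> by (simp_all add: s_def add_nonneg_pos)
  have hk: "pos (h + k)" by (rule pos_add [OF h k])
  have "pos (s *\<^sub>r 1 - (h + k))"
    using s pos_selfadjoint [OF hk]
    by (intro posI [of _ s]) (simp_all only: star_diff star_scaleC star_one complex_cnj_complex_of_real diff_diff_eq2 add_diff_cancel_left')
  from pos_scale [OF pos_add [OF this k], of "1/s"]
  have "pos (1 - (1/s) *\<^sub>r h)"
    using s by (simp add: scaleC_linear algebra_simps)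
  moreover have "pos ((1/s) *\<^sub>r h)"
    using s h by (intro pos_scale) auto
  ultimately have "p ((1/s) *\<^sub>r h) \<le> 1"
    by (intro pos_contraction)
  then have "p h \<le> s"
    using s by (simp add: scaleC norm_divide)
  then show "p h \<le> p (h + k) + e"
    by (simp add: s_def)
qed

end

section \<open>Positivity of star squares\<close>

text \<open>The arithmetic that closes \<open>negative_square_small\<close>, with \<alpha> = p(z)^2
  and G = p(g). As G is at least \<alpha> - e, the first hypothesis reads 2 \<alpha>^4 <= \<alpha>^4
  plus terms of order e; expanding gives 69 = 6 + 14 + 49.\<close>

lemma negative_square_estimate:
  fixes \<alpha> e G M :: real
  assumes "2 * \<alpha> * G ^ 3 \<le> (\<alpha>\<^sup>2 + 7 * M * e)\<^sup>2" "\<alpha> \<le> G + e"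
    and \<alpha>: "0 \<le> \<alpha>" "\<alpha> \<le> M" "1 \<le> M" and e: "0 \<le> e" "e \<le> 1"
  shows "\<alpha> ^ 4 \<le> 69 * M ^ 3 * e"
proof (cases "\<alpha> \<le> e")
  case True
  have "\<alpha> ^ 3 * \<alpha> \<le> M ^ 3 * e"
    using True \<alpha> by (intro mult_mono power_mono) auto
  moreover have "M ^ 3 * e \<le> 69 * M ^ 3 * e"
    using \<alpha> e by (simp add: mult_right_mono)
  ultimately show ?thesis by (simp add: power4_eq_xxxx power3_eq_cube)
next
  case False
  have "(\<alpha> - e) ^ 3 \<le> G ^ 3"
    using False assms by (intro power_mono) auto
  moreover have "\<alpha> ^ 3 - 3 * \<alpha>\<^sup>2 * e \<le> (\<alpha> - e) ^ 3"
  proof -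
    have "e\<^sup>2 * e \<le> e\<^sup>2 * (3 * \<alpha>)"
      using False e by (intro mult_left_mono) auto
    then show ?thesis
      by (simp add: power3_eq_cube power2_eq_square algebra_simps)
  qed
  ultimately have "2 * \<alpha> * (\<alpha> ^ 3 - 3 * \<alpha>\<^sup>2 * e) \<le> 2 * \<alpha> * G ^ 3"
    using \<alpha> by (intro mult_left_mono) auto
  with assms(1) have "2 * \<alpha> * (\<alpha> ^ 3 - 3 * \<alpha>\<^sup>2 * e) \<le> (\<alpha>\<^sup>2 + 7 * M * e)\<^sup>2"
    by linarith
  then have *: "\<alpha> ^ 4 \<le> 6 * (\<alpha> ^ 3 * e) + 14 * (M * \<alpha>\<^sup>2 * e) + 49 * (M\<^sup>2 * e * e)"
    by (simp add: power3_eq_cube power2_eq_square power4_eq_xxxx algebra_simps)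
  have "\<alpha> ^ 3 * e \<le> M ^ 3 * e"
    using \<alpha> e by (intro mult_right_mono power_mono) auto
  moreover have "M * \<alpha>\<^sup>2 * e \<le> M * M\<^sup>2 * e"
    using \<alpha> e by (intro mult_right_mono mult_left_mono power_mono) auto
  moreover have "M\<^sup>2 * e * e \<le> M\<^sup>2 * M * 1 * e"
    using \<alpha> e by (intro mult_right_mono mult_mono) auto
  ultimately show ?thesis
    using * by (simp add: power3_eq_cube power2_eq_square)
qed

context unital_cstar_seminormed
begin

text \<open>For w^2 close to g, the self-adjoint element g w has the square g w^2 g, which is close
  to g^3.\<close>

lemma pos_cube:
  assumes g: "pos g"
  shows "pos (g * g * g)"
proof (rule pos_closed)
  show "star (g * g * g) = g * g * g"
    by (simp add: star_simps pos_selfadjoint [OF g] mult.assoc)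
next
  fix e :: real
  assume e: "0 < e"
  define K where "K = p g * p g + 1"
  have K: "0 < K" "p g * p g \<le> K" by (simp_all add: K_def add_nonneg_pos)
  obtain w where w: "pos w" "p (w * w - g) \<le> e / K" and comm: "\<And>y. y * g = g * y \<Longrightarrow> y * w = w * y"
    using approx_sqrt [OF g, of "e / K"] e K by (metis divide_pos_pos)
  have gw: "g * w = w * g" by (rule comm) simp
  have "pos ((g * w) * (g * w))"
    by (rule pos_square) (simp add: star_simps pos_selfadjoint g w gw)
  moreover have "(g * w) * (g * w) - g * g * g = g * (w * w - g) * g"
  proof -
    have "(g * w) * (g * w) = g * w * (w * g)" by (simp only: gw)
    then show ?thesis by (simp add: algebra_simps)
  qed
  moreover have "p (g * (w * w - g) * g) \<le> p g * (e / K) * p g"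
    by (intro submult_le w order_refl)
  moreover have "p g * (e / K) * p g \<le> e"
    using K e by (simp add: divide_le_eq mult_right_mono mult.commute mult.left_commute)
  ultimately show "\<exists>h. pos h \<and> p (h - g * g * g) \<le> e"
    by (metis order_trans)
qed

text \<open>If \<open>star z * z\<close> is negative up to \<open>e\<close>, then \<open>z * star z\<close> is positive up to \<open>e\<close>, since the
  sum of both is positive. This bounds \<open>\<alpha> 1 - z * star z\<close> by about \<open>\<alpha> = (p z)\<^sup>2\<close>, and hence also
  \<open>star z * (\<alpha> 1 - z * star z) * z\<close>, which is close to \<open>- (\<alpha> g + g\<^sup>2)\<close>; but the norm of
  \<open>\<alpha> g + g\<^sup>2\<close> ought to be about \<open>2 \<alpha>\<^sup>2\<close>.\<close>

lemma negative_square_small: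
  assumes g: "pos g" and d: "p (star z * z + g) \<le> e" and e: "e \<le> 1"
    and M: "(p z)\<^sup>2 \<le> M" "1 \<le> M"
  shows "((p z)\<^sup>2) ^ 4 \<le> 69 * M ^ 3 * e"
proof (rule negative_square_estimate)
  let ?x = "star z * z" and ?\<alpha> = "(p z)\<^sup>2"
  let ?d = "?x + g"
  note sag = pos_selfadjoint [OF g]
  have e0: "0 \<le> e" using d nonneg order_trans by blast
  show "0 \<le> ?\<alpha>" "?\<alpha> \<le> M" "1 \<le> M" "0 \<le> e" "e \<le> 1" using M e e0 by auto
  have px: "p ?x = ?\<alpha>" by (rule cstar)
  show "?\<alpha> \<le> p g + e"
    using le_via [of ?x "- g"] d px by simp
  have pg: "p g \<le> ?\<alpha> + e"
    using le_via [of g "- ?x"] d px by (simp add: add.commute)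
  \<comment> \<open>Up to sign, twice the real and twice the imaginary part of z.\<close>
  let ?u = "z + star z" and ?v = "\<i> *\<^sub>C (z - star z)"
  have uv: "?u * ?u + ?v * ?v = 2 *\<^sub>r (z * star z + ?x)"
    using scaleC_add_left [of 1 1 "z * star z + ?x"]
    by (simp add: scaleC_mult_left scaleC_mult_right scaleC_linear algebra_simps)
  have "pos (?u * ?u + ?v * ?v)"
    by (intro pos_add pos_square) (simp_all add: star_simps scaleC_linear algebra_simps)
  from pos_scale [OF this, of "1/2"] have sum: "pos (z * star z + ?x)"
    unfolding uv by (simp add: scaleC_scaleC scaleC_one)
  \<comment> \<open>Adding this to the positive element z \<open>star z\<close> + x + g cancels x +
    g and leaves z \<open>star z\<close> + e 1.\<close>
  have "pos (e *\<^sub>r 1 - ?d)"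
    using d by (intro posI [of _ e]) (simp_all add: star_simps sag add.commute)
  from pos_add [OF pos_add [OF sum g] this] have y: "pos (z * star z + e *\<^sub>r 1)"
    by (simp add: algebra_simps)
  have "p (z * star z) \<le> ?\<alpha>"
    using submult [of z "star z"] by (simp add: star power2_eq_square)
  then have "p (z * star z + e *\<^sub>r 1) \<le> ?\<alpha> + e"
    by (intro order_trans [OF triangle] add_mono scale_one_le e0)
  \<comment> \<open>With the witness \<alpha> + e the two multiples e 1 cancel.\<close>
  from pos_norm_bound [OF y this] have "p (?\<alpha> *\<^sub>r 1 - z * star z) \<le> ?\<alpha> + e"
    by (simp add: scaleC_linear)
  then have "p (star z * (?\<alpha> *\<^sub>r 1 - z * star z) * z) \<le> p z * (?\<alpha> + e) * p z"
    by (intro submult_le) (simp_all add: star)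
  then have "p (?\<alpha> *\<^sub>r ?x - ?x * ?x) \<le> ?\<alpha> * (?\<alpha> + e)"
    by (simp add: algebra_simps scaleC_mult_left scaleC_mult_right power2_eq_square)
  moreover have "p (?\<alpha> *\<^sub>r ?d) \<le> ?\<alpha> * e"
    using d by (simp add: scaleC norm_power mult_left_mono)
  moreover have "p (?d * ?d) \<le> e * e" "p (?d * g) \<le> e * (?\<alpha> + e)" "p (g * ?d) \<le> (?\<alpha> + e) * e"
    using d pg by (intro submult_le; simp)+
  \<comment> \<open>The identity is the substitution x = d - g. Every term but the first contains
    the small factor d; altogether \<alpha> e occurs 4 times and e^2 3 times, which makes the
    7.\<close>
  moreover have "?\<alpha> *\<^sub>r g + g * g =
      - (?\<alpha> *\<^sub>r ?x - ?x * ?x) + ?\<alpha> *\<^sub>r ?d + (- (?d * ?d)) + ?d * g + g * ?d"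
    by (simp add: scaleC_add_right algebra_simps)
  then have "p (?\<alpha> *\<^sub>r g + g * g) \<le>
      p (?\<alpha> *\<^sub>r ?x - ?x * ?x) + p (?\<alpha> *\<^sub>r ?d) + p (?d * ?d) + p (?d * g) + p (g * ?d)"
    by (simp only:) (intro order_trans [OF triangle] add_mono order_refl; simp only: minus order_refl)
  ultimately have "p (?\<alpha> *\<^sub>r g + g * g) \<le> ?\<alpha>\<^sup>2 + 4 * (?\<alpha> * e) + 3 * (e * e)"
    by (simp add: power2_eq_square algebra_simps)
  moreover have "?\<alpha> * e \<le> M * e" "e * e \<le> M * e"
    using M e e0 by (intro mult_right_mono; simp)+
  ultimately have \<beta>: "p (?\<alpha> *\<^sub>r g + g * g) \<le> ?\<alpha>\<^sup>2 + 7 * M * e"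
    by linarith
  \<comment> \<open>The outer terms of (\<alpha> g + g^2)^2; dropping them by
    \<open>pos_mono\<close> isolates 2 \<alpha> g^3.\<close>
  have "pos ((?\<alpha> *\<^sub>r g) * (?\<alpha> *\<^sub>r g) + (g * g) * (g * g))"
    by (intro pos_add pos_square) (simp_all add: star_simps sag)
  moreover have "pos ((2 * ?\<alpha>) *\<^sub>r (g * g * g))"
    by (intro pos_scale pos_cube g) simp
  ultimately have "p ((2 * ?\<alpha>) *\<^sub>r (g * g * g)) \<le>
      p ((2 * ?\<alpha>) *\<^sub>r (g * g * g) + ((?\<alpha> *\<^sub>r g) * (?\<alpha> *\<^sub>r g) + (g * g) * (g * g)))"
    by (intro pos_mono)
  also have "(2 * ?\<alpha>) *\<^sub>r (g * g * g) + ((?\<alpha> *\<^sub>r g) * (?\<alpha> *\<^sub>r g) + (g * g) * (g * g)) =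
      (?\<alpha> *\<^sub>r g + g * g) * (?\<alpha> *\<^sub>r g + g * g)"
    using scaleC_add_left [of "of_real ?\<alpha>" "of_real ?\<alpha>" "g * g * g"]
    by (simp add: scaleC_mult_left scaleC_mult_right scaleC_add_right algebra_simps)
  also have "p \<dots> \<le> (?\<alpha>\<^sup>2 + 7 * M * e)\<^sup>2"
    unfolding power2_eq_square [of "?\<alpha>\<^sup>2 + 7 * M * e"] by (intro submult_le \<beta>)
  finally have le: "2 * ?\<alpha> * p (g * g * g) \<le> (?\<alpha>\<^sup>2 + 7 * M * e)\<^sup>2"
    by (simp add: scaleC norm_mult norm_power)
  \<comment> \<open>Since p(g)^4 = p(g^4) <= p(g^3) p(g), the cube has norm at least p(g)^3.\<close>
  have "p (g * g * (g * g)) = (p g) ^ 4"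
    by (simp add: selfadjoint_square star_simps sag)
  then have "(p g) ^ 3 * p g \<le> p (g * g * g) * p g"
    using submult [of "g * g * g" g] by (simp add: mult.assoc power3_eq_cube power4_eq_xxxx)
  then have "(p g) ^ 3 \<le> p (g * g * g)"
    using nonneg [of g] by (cases "p g = 0") (simp_all add: mult_le_cancel_right)
  then have "2 * ?\<alpha> * (p g) ^ 3 \<le> 2 * ?\<alpha> * p (g * g * g)"
    by (intro mult_left_mono) simp_all
  with le show "2 * ?\<alpha> * (p g) ^ 3 \<le> (?\<alpha>\<^sup>2 + 7 * M * e)\<^sup>2"
    by linarith
qed

text \<open>The Kelley--Vaught argument: with \<open>b = star c * c\<close>, \<open>a\<close> close to \<open>\<bar>b\<bar>\<close> and \<open>r\<close> close to
  \<open>sqrt a\<close>, the square of \<open>z = 2 * c * (a - b) * r\<close> is close to \<open>- (a - b) ^ 4\<close>.\<close>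

lemma star_square_near_pos:
  assumes B: "p (star c * c) \<le> B" "1 \<le> B" and e: "0 < e" "e \<le> 1"
  obtains a \<alpha> where "pos a" "p (a - star c * c) ^ 4 \<le> \<alpha> + e" "\<alpha> ^ 4 \<le> 69 * (108 * B ^ 4) ^ 3 * e"
proof -
  define b where "b = star c * c"
  have sab: "star b = b" by (simp add: b_def star_simps)
  have pb: "p b \<le> B" using B by (simp add: b_def)
  \<comment> \<open>37 = 36 + 1 collects the final errors: 4 * 3 B * 3 B * B \<epsilon> from the
    root r, and \<epsilon>^2 <= B^3 \<epsilon> from the root a.\<close>
  define \<epsilon> where "\<epsilon> = e / (37 * B ^ 3)"
  have B3: "1 \<le> B ^ 3" using B by simp
  have \<epsilon>: "0 < \<epsilon>" "37 * B ^ 3 * \<epsilon> = e" using B e by (simp_all add: \<epsilon>_def)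
  have "\<epsilon> \<le> 1"
  proof -
    have "e \<le> 37 * B ^ 3" using e B3 by linarith
    then show ?thesis using B by (simp add: \<epsilon>_def divide_le_eq)
  qed
  obtain a where a: "pos a" "p (a * a - b * b) \<le> \<epsilon>" and ac: "\<And>y. y * (b * b) = (b * b) * y \<Longrightarrow> y * a = a * y"
    using approx_sqrt [OF pos_square [OF sab] \<epsilon>(1)] by metis
  note saa = pos_selfadjoint [OF a(1)]
  obtain r where r: "pos r" "p (r * r - a) \<le> \<epsilon>" and rc: "\<And>y. y * a = a * y \<Longrightarrow> y * r = r * y"
    using approx_sqrt [OF a(1) \<epsilon>(1)] by metis
  note sar = pos_selfadjoint [OF r(1)]
  have ba: "b * a = a * b" by (rule ac) (simp add: mult.assoc)
  have br: "b * r = r * b" by (rule rc [OF ba])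
  have ar: "a * r = r * a" by (rule rc) simp
  define m where "m = a - b"
  have sam: "star m = m" by (simp add: m_def star_simps saa sab)
  have mr: "m * r = r * m" by (simp add: m_def algebra_simps ar br)
  have mb: "m * b = b * m" by (simp add: m_def algebra_simps ba)
  have "(p a)\<^sup>2 \<le> \<epsilon> + B * B"
    using le_via [of "a * a" "b * b"] a(2) submult_le [OF pb pb]
    by (simp add: selfadjoint_square [OF saa, symmetric])
  also have "\<dots> \<le> (2 * B)\<^sup>2"
    using \<open>\<epsilon> \<le> 1\<close> mult_mono [OF B(2) B(2)] B by (simp add: power2_eq_square)
  finally have pa: "p a \<le> 2 * B"
    by (rule power2_le_imp_le) (use B in simp)
  then have pm: "p m \<le> 3 * B"
    using triangle_diff [of a b] pb by (simp add: m_def)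
  have pr: "(p r)\<^sup>2 \<le> 3 * B"
    using le_via [of "r * r" a] r(2) pa \<open>\<epsilon> \<le> 1\<close> B
    by (simp add: selfadjoint_square [OF sar, symmetric])
  define z where "z = 2 *\<^sub>r (c * m * r)"
  have "p z \<le> 2 * (p c * p m * p r)"
    unfolding z_def scaleC by (simp, intro submult_le order_refl)
  then have "(p z)\<^sup>2 \<le> (2 * (p c * p m * p r))\<^sup>2"
    by (intro power_mono) auto
  also have "\<dots> = 4 * ((p c)\<^sup>2 * (p m)\<^sup>2 * (p r)\<^sup>2)"
    by (simp add: power_mult_distrib)
  also have "\<dots> \<le> 4 * (B * (3 * B)\<^sup>2 * (3 * B))"
    using B pm pr pb by (intro mult_left_mono mult_mono power_mono) (simp_all add: b_def cstar)
  also have "\<dots> = 108 * B ^ 4"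
    by (simp add: power2_eq_square power4_eq_xxxx)
  finally have pz: "(p z)\<^sup>2 \<le> 108 * B ^ 4" .
  have zz: "star z * z = 4 *\<^sub>r (r * m * b * m * r)"
    by (simp add: z_def star_simps sam sar b_def scaleC_mult_left scaleC_mult_right scaleC_scaleC mult.assoc)
  also have "r * m * b * m * r = m * m * (b * (r * r))"
    by (metis mult.assoc mr mb br)
  finally have zz: "star z * z = 4 *\<^sub>r (m * m * (b * (r * r)))" .
  \<comment> \<open>From 4 b a = (a + b)^2 - m^2 and m (a + b) = a^2 - b^2 it follows that 4 m^2 b a
    = (a^2 - b^2)^2 - m^4; replacing r^2 by a in \<open>star z * z\<close> costs only
    \<epsilon>.\<close>
  have aabb: "(a - b) * (a + b) = a * a - b * b"
    by (simp add: algebra_simps ba)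
  have m_ab: "m * (a + b) = (a + b) * m"
    by (simp add: m_def algebra_simps ba)
  have "(a * a - b * b) * (a * a - b * b) = (m * (a + b)) * (m * (a + b))"
    by (simp add: aabb m_def)
  also have "\<dots> = m * m * ((a + b) * (a + b))"
    by (metis m_ab mult.assoc)
  also have "(a + b) * (a + b) = m * m + 4 *\<^sub>r (b * a)"
    using scaleC_add_left [of 2 2 "b * a"] scaleC_add_left [of 1 1 "b * a"]
    by (simp add: m_def algebra_simps ba scaleC_one)
  finally have "star z * z + (m * m) * (m * m) =
      4 *\<^sub>r (m * m * (b * (r * r - a))) + (a * a - b * b) * (a * a - b * b)"
    by (simp add: zz algebra_simps scaleC_linear scaleC_mult_right)
  then have "p (star z * z + (m * m) * (m * m)) \<le>
      4 * p (m * m * (b * (r * r - a))) + p ((a * a - b * b) * (a * a - b * b))"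
    by (metis (no_types, lifting) scaleC triangle norm_of_real abs_numeral of_real_numeral norm_numeral)
  also have "\<dots> \<le> 4 * (3 * B * (3 * B) * (B * \<epsilon>)) + \<epsilon> * \<epsilon>"
    by (intro add_mono mult_left_mono submult_le pm pb a r) simp
  also have "\<dots> \<le> 4 * (3 * B * (3 * B) * (B * \<epsilon>)) + B ^ 3 * \<epsilon>"
    using \<epsilon> \<open>\<epsilon> \<le> 1\<close> B3 by (intro add_left_mono mult_right_mono) auto
  also have "\<dots> = e"
    by (simp add: \<epsilon>(2) [symmetric] power3_eq_cube)
  finally have d: "p (star z * z + (m * m) * (m * m)) \<le> e" .
  \<comment> \<open>m^4 plays the positive element g of
    \<open>negative_square_small\<close>.\<close>
  have "pos ((m * m) * (m * m))"
    by (rule pos_square) (simp add: star_simps sam)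
  moreover have "1 \<le> 108 * B ^ 4"
    using one_le_power [OF B(2), of 4] by linarith
  ultimately have "((p z)\<^sup>2) ^ 4 \<le> 69 * (108 * B ^ 4) ^ 3 * e"
    using d e pz by (intro negative_square_small) auto
  moreover have "p m ^ 4 \<le> (p z)\<^sup>2 + e"
  proof -
    have "p ((m * m) * (m * m)) = p m ^ 4"
      by (simp add: selfadjoint_square star_simps sam)
    then show ?thesis
      using le_via [of "(m * m) * (m * m)" "- (star z * z)"] d by (simp add: cstar add.commute)
  qed
  ultimately show thesis
    using that [OF a(1)] by (simp add: m_def b_def)
qed

text \<open>The elements a of \<open>star_square_near_pos\<close> are positive and come arbitrarily
  close, so \<open>pos_closed\<close> applies.\<close>

lemma pos_star_square: "pos (star c * c)"
proof (rule pos_closed)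
  show "star (star c * c) = star c * c" by (simp add: star_simps)
next
  fix e :: real
  assume e: "0 < e"
  define B where "B = p (star c * c) + 1"
  have B: "p (star c * c) \<le> B" "1 \<le> B" by (simp_all add: B_def)
  define K where "K = 69 * (108 * B ^ 4) ^ 3"
  have K: "0 < K" using B by (simp add: K_def)
  \<comment> \<open>The fourth power of the distance is at most \<alpha> + e', so each summand gets
    half of e^4; the last entry makes K e' at most (e^4 / 2)^4, which controls \<alpha>.\<close>
  define e' where "e' = min 1 (min (e ^ 4 / 2) ((e ^ 4 / 2) ^ 4 / K))"
  have e': "e' \<le> 1" "e' \<le> e ^ 4 / 2" "e' \<le> (e ^ 4 / 2) ^ 4 / K"
    unfolding e'_def by (intro min.cobounded1 min.coboundedI2 [OF min.cobounded1]
      min.coboundedI2 [OF min.cobounded2])+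
  have "0 < e'" using e K by (simp add: e'_def)
  obtain a \<alpha> where a: "pos a" "p (a - star c * c) ^ 4 \<le> \<alpha> + e'" "\<alpha> ^ 4 \<le> K * e'"
    using star_square_near_pos [OF B \<open>0 < e'\<close> e'(1)] unfolding K_def by metis
  have "K * e' \<le> (e ^ 4 / 2) ^ 4"
    using e'(3) K by (simp add: pos_le_divide_eq mult.commute)
  with a have "\<alpha> ^ 4 \<le> (e ^ 4 / 2) ^ 4" by linarith
  then have "\<alpha> \<le> e ^ 4 / 2"
    \<comment> \<open>The rule is stated for the exponent \<open>Suc n\<close>, hence 3 for a fourth
      power.\<close>
    using e by (intro power_le_imp_le_base [of \<alpha> 3]) (simp_all add: eval_nat_numeral)
  with a e' have "p (a - star c * c) ^ 4 \<le> e ^ 4" by linarith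
  then have "p (a - star c * c) \<le> e"
    using e by (simp only: power_mono_iff nonneg less_imp_le zero_less_numeral)
  with a show "\<exists>g. pos g \<and> p (g - star c * c) \<le> e" by blast
qed

text \<open>For w^2 close to k the element is close to the star square of w a.\<close>

lemma pos_conjugate:
  assumes k: "pos k"
  shows "pos (star a * k * a)"
proof (rule pos_closed)
  show "star (star a * k * a) = star a * k * a"
    by (simp add: star_simps pos_selfadjoint [OF k] mult.assoc)
next
  fix e :: real
  assume e: "0 < e"
  define K where "K = p a * p a + 1"
  have K: "0 < K" "p a * p a \<le> K" by (simp_all add: K_def add_nonneg_pos)
  obtain w where w: "pos w" "p (w * w - k) \<le> e / K"
    using approx_sqrt [OF k, of "e / K"] e K by (metis divide_pos_pos)
  have "star (w * a) * (w * a) - star a * k * a = star a * (w * w - k) * a"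
    by (simp add: star_simps pos_selfadjoint [OF w(1)] algebra_simps)
  moreover have "p (star a * (w * w - k) * a) \<le> p a * (e / K) * p a"
    by (intro submult_le w) (simp_all add: star)
  moreover have "p a * (e / K) * p a \<le> e"
    using K e by (simp add: divide_le_eq mult_right_mono mult.commute mult.left_commute)
  ultimately show "\<exists>h. pos h \<and> p (h - star a * k * a) \<le> e"
    by (metis order_trans pos_star_square)
qed

end

section \<open>The unitization\<close>

datatype 'a unitization = Unitization (scalar_part: complex) (algebra_part: 'a)

instantiation unitization :: (complex_star_algebra) "{complex_star_algebra, ring_1}"
begin

definition "0 = Unitization 0 0"
definition "1 = Unitization 1 0"
definition "x + y = Unitization (scalar_part x + scalar_part y) (algebra_part x + algebra_part y)"
definition "x - y = Unitization (scalar_part x - scalar_part y) (algebra_part x - algebra_part y)"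
definition "- x = Unitization (- scalar_part x) (- algebra_part x)"
definition "x * y = Unitization (scalar_part x * scalar_part y)
  (scalar_part x *\<^sub>C algebra_part y + scalar_part y *\<^sub>C algebra_part x + algebra_part x * algebra_part y)"
definition "c *\<^sub>C x = Unitization (c * scalar_part x) (c *\<^sub>C algebra_part x)"
definition "star x = Unitization (cnj (scalar_part x)) (star (algebra_part x))"

lemmas unitization_defs = zero_unitization_def one_unitization_def plus_unitization_def
  minus_unitization_def uminus_unitization_def times_unitization_def scaleC_unitization_def
  star_unitization_def

instance
  by standard
    (simp_all add: unitization_defs scaleC_linear scaleC_mult_left scaleC_mult_right star_simps
      algebra_simps)

end

definition unitization_act :: "'a::complex_star_algebra unitization \<Rightarrow> 'a \<Rightarrow> 'a"
  where "unitization_act x b = scalar_part x *\<^sub>C b + algebra_part x * b"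

lemma unitization_act_simps:
  "unitization_act (x + y) b = unitization_act x b + unitization_act y b"
  "unitization_act (c *\<^sub>C x) b = c *\<^sub>C unitization_act x b"
  "unitization_act (x * y) b = unitization_act x (unitization_act y b)"
  "unitization_act x (c *\<^sub>C b) = c *\<^sub>C unitization_act x b"
  by (simp_all add: unitization_act_def unitization_defs scaleC_linear scaleC_mult_left
      scaleC_mult_right algebra_simps)

text \<open>Carries the C*-identity from \<open>p\<close> to the unitization: the left side has the
  seminorm p(x b)^2, and the right side contains \<open>star x * x\<close>.\<close>

lemma star_unitization_act:
  "star (unitization_act x b) * unitization_act x b = star b * unitization_act (star x * x) b"
  by (simp add: unitization_act_def unitization_defs scaleC_linear scaleC_mult_left
      scaleC_mult_right star_simps algebra_simps)

section \<open>The operator seminorm on the unitization, and Cauchy-Schwarz\<close>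

context cstar_seminormed
begin

text \<open>The operator seminorm of left multiplication; adding the modulus of the scalar part to
  \<open>p\<close> of the algebra part would in general violate the C*-identity. It may vanish on
  nonzero elements: if the algebra has a unit u, then 1 - u acts as zero.\<close>

definition unitization_norm :: "'b unitization \<Rightarrow> real"
  where "unitization_norm x = Sup {p (unitization_act x b) | b. p b \<le> 1}"

lemma unitization_act_bound:
  "p (unitization_act x b) \<le> (cmod (scalar_part x) + p (algebra_part x)) * p b"
  using triangle [of "scalar_part x *\<^sub>C b" "algebra_part x * b"] submult [of "algebra_part x" b]
  by (simp add: unitization_act_def scaleC algebra_simps)

lemma unitization_norm_upper_unit_ball:
  assumes "p b \<le> 1"
  shows "p (unitization_act x b) \<le> unitization_norm x"
proof -
  let ?K = "cmod (scalar_part x) + p (algebra_part x)"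
  have "bdd_above {p (unitization_act x b) | b. p b \<le> 1}"
  proof (rule bdd_aboveI)
    fix r
    assume "r \<in> {p (unitization_act x b) | b. p b \<le> 1}"
    then obtain b where "p b \<le> 1" "r = p (unitization_act x b)" by blast
    then show "r \<le> ?K"
      using unitization_act_bound [of x b] mult_left_mono [of "p b" 1 ?K] by simp
  qed
  then show ?thesis
    unfolding unitization_norm_def using assms by (intro cSup_upper) auto
qed

lemma unitization_norm_nonneg: "0 \<le> unitization_norm x"
  using unitization_norm_upper_unit_ball [of 0 x] by (simp add: unitization_act_def)

lemma unitization_norm_upper: "p (unitization_act x b) \<le> unitization_norm x * p b"
proof (cases "p b = 0")
  case True
  then show ?thesis using unitization_act_bound [of x b] by simp
next
  case False
  then have "0 < p b"
    using nonneg [of b] by linarith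
  then have "p ((1 / p b) *\<^sub>r b) \<le> 1"
    by (simp add: scaleC norm_divide)
  from unitization_norm_upper_unit_ball [OF this, of x] show ?thesis
    using \<open>0 < p b\<close> by (simp add: unitization_act_simps scaleC norm_divide divide_le_eq)
qed

lemma unitization_norm_least:
  assumes "\<And>b. p (unitization_act x b) \<le> K * p b" "0 \<le> K"
  shows "unitization_norm x \<le> K"
  unfolding unitization_norm_def
proof (rule cSup_least)
  show "{p (unitization_act x b) | b. p b \<le> 1} \<noteq> {}"
    by (auto intro: exI [of _ 0])
next
  fix r
  assume "r \<in> {p (unitization_act x b) | b. p b \<le> 1}"
  then obtain b where "p b \<le> 1" "r = p (unitization_act x b)" by blast
  then show "r \<le> K"
    using assms(1) [of b] mult_left_mono [of "p b" 1 K] assms(2) by simp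
qed

lemma unitization_norm_mult: "unitization_norm (x * y) \<le> unitization_norm x * unitization_norm y"
proof (rule unitization_norm_least)
  fix b
  have "p (unitization_act (x * y) b) \<le> unitization_norm x * p (unitization_act y b)"
    by (simp add: unitization_act_simps unitization_norm_upper)
  also have "\<dots> \<le> unitization_norm x * (unitization_norm y * p b)"
    by (intro mult_left_mono unitization_norm_upper unitization_norm_nonneg)
  finally show "p (unitization_act (x * y) b) \<le> unitization_norm x * unitization_norm y * p b"
    by (simp add: mult.assoc)
qed (simp add: unitization_norm_nonneg)

text \<open>Writing N for the seminorm, \<open>star_unitization_act\<close> yields N(x)^2 <=
  N(\<open>star x * x\<close>). With submultiplicativity this gives N(x) <=
  N(\<open>star x\<close>), hence equality, hence the reverse inequality.\<close>

lemma unitization_norm_cstar: "unitization_norm (star x * x) = (unitization_norm x)\<^sup>2"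
proof -
  have le: "(unitization_norm y)\<^sup>2 \<le> unitization_norm (star y * y)" for y
  proof -
    have "unitization_norm y \<le> sqrt (unitization_norm (star y * y))"
    proof (rule unitization_norm_least)
      fix b
      have "(p (unitization_act y b))\<^sup>2 \<le> p (star b) * p (unitization_act (star y * y) b)"
        unfolding cstar [symmetric] star_unitization_act by (rule submult)
      also have "\<dots> \<le> p b * (unitization_norm (star y * y) * p b)"
        by (simp add: star mult_left_mono unitization_norm_upper)
      also have "\<dots> = (sqrt (unitization_norm (star y * y)) * p b)\<^sup>2"
        by (simp add: power_mult_distrib unitization_norm_nonneg) (simp add: power2_eq_square)
      finally show "p (unitization_act y b) \<le> sqrt (unitization_norm (star y * y)) * p b"
        by (rule power2_le_imp_le) (simp add: unitization_norm_nonneg)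
    qed (simp add: unitization_norm_nonneg)
    from power_mono [OF this unitization_norm_nonneg, of 2] show ?thesis
      by (simp add: unitization_norm_nonneg)
  qed
  have star_le: "unitization_norm y \<le> unitization_norm (star y)" for y
  proof (cases "unitization_norm y = 0")
    case False
    then have "0 < unitization_norm y"
      using unitization_norm_nonneg [of y] by linarith
    moreover have "unitization_norm y * unitization_norm y \<le> unitization_norm (star y) * unitization_norm y"
      using le [of y] unitization_norm_mult [of "star y" y] by (simp add: power2_eq_square)
    ultimately show ?thesis by simp
  qed (simp add: unitization_norm_nonneg)
  have "unitization_norm (star x) = unitization_norm x"
    using star_le [of x] star_le [of "star x"] by (simp add: star_star)
  then show ?thesis
    using le [of x] unitization_norm_mult [of "star x" x] by (simp add: power2_eq_square)
qed

lemma cstar_seminorm_unitization_norm: "cstar_seminorm unitization_norm"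
  unfolding cstar_seminorm_def
proof (intro conjI allI)
  fix x y :: "'b unitization"
  show "unitization_norm (x + y) \<le> unitization_norm x + unitization_norm y"
  proof (rule unitization_norm_least)
    fix b
    show "p (unitization_act (x + y) b) \<le> (unitization_norm x + unitization_norm y) * p b"
      unfolding unitization_act_simps distrib_right
      by (intro order_trans [OF triangle] add_mono unitization_norm_upper)
  qed (simp add: unitization_norm_nonneg)
next
  fix c and x :: "'b unitization"
  have le: "unitization_norm (d *\<^sub>C y) \<le> cmod d * unitization_norm y" for d and y :: "'b unitization"
  proof (rule unitization_norm_least)
    fix b
    show "p (unitization_act (d *\<^sub>C y) b) \<le> cmod d * unitization_norm y * p b"
      by (simp add: unitization_act_simps scaleC mult.assoc mult_left_mono unitization_norm_upper)
  qed (simp add: unitization_norm_nonneg)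
  show "unitization_norm (c *\<^sub>C x) = cmod c * unitization_norm x"
  proof (cases "c = 0")
    case True
    then show ?thesis
      using le [of 0 x] unitization_norm_nonneg [of "0 *\<^sub>C x"] by simp
  next
    case False
    then have "unitization_norm x \<le> unitization_norm (c *\<^sub>C x) / cmod c"
      using le [of "1 / c" "c *\<^sub>C x"] by (simp add: scaleC_scaleC scaleC_one norm_divide)
    with False le [of c x] show ?thesis
      by (simp add: le_divide_eq mult.commute)
  qed
qed (simp_all add: unitization_norm_nonneg unitization_norm_mult unitization_norm_cstar)

lemma unital_unitization_norm: "unital_cstar_seminormed unitization_norm"
  by (intro unital_cstar_seminormed.intro cstar_seminormed.intro cstar_seminorm_unitization_norm)

text \<open>The lower bound tests left multiplication by a on \<open>star a\<close>.\<close>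

lemma unitization_norm_embedding: "unitization_norm (Unitization 0 a) = p a"
proof (rule antisym)
  show "unitization_norm (Unitization 0 a) \<le> p a"
    by (rule unitization_norm_least) (simp_all add: unitization_act_def submult)
  have "(p (star a))\<^sup>2 \<le> unitization_norm (Unitization 0 a) * p (star a)"
    using unitization_norm_upper [of "Unitization 0 a" "star a"] cstar [of "star a"]
    by (simp add: unitization_act_def star_star)
  then show "p a \<le> unitization_norm (Unitization 0 a)"
    using nonneg [of a] unitization_norm_nonneg [of "Unitization 0 a"]
    by (cases "p a = 0") (simp_all add: star power2_eq_square mult_le_cancel_right)
qed

text \<open>Positivity relative to one seminorm and to the adjoined unit; elements that are
  \<open>cstar_positive\<close> have it for every C*-seminorm.\<close>

definition psd :: "'b \<Rightarrow> bool"
  where "psd a \<longleftrightarrow> unital_cstar_seminormed.pos unitization_norm (Unitization 0 a)"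

lemma psd_star_square: "psd (star c * c)"
  using unital_cstar_seminormed.pos_star_square [OF unital_unitization_norm, of "Unitization 0 c"]
  by (simp add: psd_def unitization_defs)

lemma psd_zero: "psd 0"
  using psd_star_square [of 0] by simp

lemma psd_add: "psd a \<Longrightarrow> psd b \<Longrightarrow> psd (a + b)"
  using unital_cstar_seminormed.pos_add [OF unital_unitization_norm, of "Unitization 0 a" "Unitization 0 b"]
  by (simp add: psd_def unitization_defs)

lemma psd_sum: "(\<And>i. i \<in> I \<Longrightarrow> psd (f i)) \<Longrightarrow> psd (\<Sum>i\<in>I. f i)"
  by (induction I rule: infinite_finite_induct) (auto intro: psd_zero psd_add)

lemma psd_mono: "psd a \<Longrightarrow> psd b \<Longrightarrow> p a \<le> p (a + b)"
  using unital_cstar_seminormed.pos_mono [OF unital_unitization_norm, of "Unitization 0 a" "Unitization 0 b"]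
  by (simp add: psd_def unitization_norm_embedding plus_unitization_def)

text \<open>Cauchy--Schwarz for an \<open>A\<close>-valued semi-inner product with \<open>X = \<langle>x, x\<rangle>\<close>, \<open>Z = \<langle>x, y\<rangle>\<close> and
  \<open>Y = \<langle>y, y\<rangle>\<close>; the hypothesis is the positivity of \<open>\<langle>x a - y, x a - y\<rangle>\<close>.\<close>

lemma cauchy_schwarz:
  assumes X: "psd X" and XYZ: "\<And>a. psd (star a * X * a - star a * Z - star Z * a + Y)"
  shows "(p Z)\<^sup>2 \<le> p X * p Y"
proof -
  interpret u: unital_cstar_seminormed unitization_norm
    by (rule unital_unitization_norm)
  \<comment> \<open>Unlike p(X), a number s strictly above it can be divided by; the excess tends to
    0 at the end.\<close>
  have "(p Z)\<^sup>2 \<le> s * p Y" if s: "p X < s" for s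
  proof -
    have "0 < s" using s nonneg [of X] by linarith
    \<comment> \<open>This a minimizes the quadratic expression in which X is replaced by its upper
      bound s. Conjugating s 1 - X by a gives the term that eliminates X from the
      hypothesis.\<close>
    define a where "a = (1/s) *\<^sub>r Z"
    have "u.pos (s *\<^sub>r 1 - Unitization 0 X)"
    proof (rule u.posI)
      show "star (s *\<^sub>r 1 - Unitization 0 X) = s *\<^sub>r 1 - Unitization 0 X"
        using u.pos_selfadjoint [OF X [unfolded psd_def]] by (simp add: star_simps)
      show "unitization_norm (s *\<^sub>r 1 - (s *\<^sub>r 1 - Unitization 0 X)) \<le> s"
        using s by (simp add: unitization_norm_embedding)
    qed
    from u.pos_conjugate [OF this, of "Unitization 0 a"]
    have "psd (s *\<^sub>r (star a * a) - star a * X * a)"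
      unfolding psd_def
      by (simp add: unitization_defs scaleC_mult_left scaleC_mult_right algebra_simps)
    from psd_add [OF XYZ [of a] this]
    have "psd (s *\<^sub>r (star a * a) - star a * Z - star Z * a + Y)"
      by (simp add: algebra_simps)
    also have "s *\<^sub>r (star a * a) - star a * Z - star Z * a + Y = Y - (1/s) *\<^sub>r (star Z * Z)"
      using \<open>0 < s\<close> by (simp add: a_def star_simps scaleC_mult_left scaleC_mult_right scaleC_scaleC)
    finally have "psd (Y - (1/s) *\<^sub>r (star Z * Z))" .
    moreover have "psd ((1/s) *\<^sub>r (star Z * Z))"
    proof -
      have "star ((1 / sqrt s) *\<^sub>r Z) * ((1 / sqrt s) *\<^sub>r Z) = (1/s) *\<^sub>r (star Z * Z)"
        using \<open>0 < s\<close> by (simp add: star_simps scaleC_mult_left scaleC_mult_right scaleC_scaleC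
            flip: of_real_mult)
      then show ?thesis using psd_star_square by metis
    qed
    ultimately have "p ((1/s) *\<^sub>r (star Z * Z)) \<le> p Y"
      using psd_mono [of "(1/s) *\<^sub>r (star Z * Z)" "Y - (1/s) *\<^sub>r (star Z * Z)"] by simp
    then show ?thesis
      using \<open>0 < s\<close> by (simp add: scaleC cstar norm_divide divide_le_eq mult.commute)
  qed
  then have le: "(p Z)\<^sup>2 \<le> (p X + e) * p Y" if "0 < e" for e
    using that by simp
  show ?thesis
  proof (rule field_le_epsilon)
    fix e :: real
    assume "0 < e"
    have "(p Z)\<^sup>2 \<le> (p X + e / (p Y + 1)) * p Y"
      using \<open>0 < e\<close> by (intro le divide_pos_pos) (auto intro: add_nonneg_pos)
    also have "\<dots> = p X * p Y + e * (p Y / (p Y + 1))"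
      by (simp add: distrib_right)
    also have "\<dots> \<le> p X * p Y + e"
      using \<open>0 < e\<close> by (intro add_left_mono mult_left_le) (auto simp: divide_le_eq add_nonneg_pos)
    finally show "(p Z)\<^sup>2 \<le> p X * p Y + e" .
  qed
qed

end

section \<open>Pro-C*-algebras\<close>

lemma tendsto_zero_iff_nonneg:
  fixes f :: "'b \<Rightarrow> real"
  assumes "\<And>x. 0 \<le> f x"
  shows "(f \<longlongrightarrow> 0) F \<longleftrightarrow> (\<forall>e>0. \<forall>\<^sub>F x in F. f x < e)"
  using assms by (simp add: tendsto_iff)

lemma tendsto_zero_mono:
  fixes f g :: "'b \<Rightarrow> real"
  assumes "(g \<longlongrightarrow> 0) F" "\<And>x. 0 \<le> f x" "\<And>x. f x \<le> g x"
  shows "(f \<longlongrightarrow> 0) F"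
  using assms by (intro tendsto_sandwich [OF _ _ tendsto_const assms(1)]) auto

text \<open>One setting for the algebra and for Hilbert modules. The triangle inequality is asked on
  \<open>V\<close> only, since for modules it rests on Cauchy-Schwarz in the carrier.\<close>

locale seminorm_family =
  fixes V :: "'v::ab_group_add set" and P :: "('v \<Rightarrow> real) set"
  assumes nonempty: "P \<noteq> {}"
    and diff_closed: "x \<in> V \<Longrightarrow> y \<in> V \<Longrightarrow> x - y \<in> V"
    and nonneg: "p \<in> P \<Longrightarrow> 0 \<le> p x"
    and zero: "p \<in> P \<Longrightarrow> p 0 = 0"
    and triangle: "p \<in> P \<Longrightarrow> x \<in> V \<Longrightarrow> y \<in> V \<Longrightarrow> p (x + y) \<le> p x + p y"
begin

lemma topspace: "topspace (seminorm_topology V P) = V"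
proof -
  obtain p where "p \<in> P" using nonempty by blast
  then have "x \<in> {y \<in> V. p (y - x) < 1}" if "x \<in> V" for x
    using that by (simp add: zero)
  with \<open>p \<in> P\<close> show ?thesis
    unfolding seminorm_topology_def topology_generated_by_topspace
    by (auto, metis zero_less_one)
qed

text \<open>The balls are used as a subbasis, so the converse goes by induction on the generation of
  the open sets.\<close>

lemma limitin_iff:
  assumes f: "\<forall>\<^sub>F x in F. f x \<in> V"
  shows "limitin (seminorm_topology V P) f l F \<longleftrightarrow>
    l \<in> V \<and> (\<forall>p\<in>P. ((\<lambda>x. p (f x - l)) \<longlongrightarrow> 0) F)"
proof
  assume lim: "limitin (seminorm_topology V P) f l F"
  then have l: "l \<in> V"
    by (simp add: limitin_def topspace)
  have "((\<lambda>x. p (f x - l)) \<longlongrightarrow> 0) F" if p: "p \<in> P" for p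
    unfolding tendsto_zero_iff_nonneg [where f = "\<lambda>x. p (f x - l)", OF nonneg [OF p]]
  proof (intro allI impI)
    fix e :: real
    assume e: "0 < e"
    have "openin (seminorm_topology V P) {y \<in> V. p (y - l) < e}"
      unfolding seminorm_topology_def using l p e
      by (intro topology_generated_by_Basis) blast
    moreover have "l \<in> {y \<in> V. p (y - l) < e}"
      using l e p by (simp add: zero)
    ultimately have "\<forall>\<^sub>F x in F. f x \<in> {y \<in> V. p (y - l) < e}"
      using lim by (auto simp: limitin_def)
    then show "\<forall>\<^sub>F x in F. p (f x - l) < e"
      by (rule eventually_mono) simp
  qed
  with l show "l \<in> V \<and> (\<forall>p\<in>P. ((\<lambda>x. p (f x - l)) \<longlongrightarrow> 0) F)" by blast
next
  assume r: "l \<in> V \<and> (\<forall>p\<in>P. ((\<lambda>x. p (f x - l)) \<longlongrightarrow> 0) F)"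
  have "\<forall>\<^sub>F x in F. f x \<in> U"
    if "generate_topology_on {{y \<in> V. p (y - x) < e} | x p e. x \<in> V \<and> p \<in> P \<and> 0 < e} U" "l \<in> U" for U
    using that
  proof (induction rule: generate_topology_on.induct)
    case (Int a b)
    then show ?case by (auto intro: eventually_conj)
  next
    case (UN K)
    then obtain k where "k \<in> K" "l \<in> k" by blast
    with UN have "\<forall>\<^sub>F x in F. f x \<in> k" by blast
    then show ?case by (rule eventually_mono) (use \<open>k \<in> K\<close> in blast)
  next
    case (Basis s)
    then obtain x p e where s: "s = {y \<in> V. p (y - x) < e}" and x: "x \<in> V" "p \<in> P" "0 < e"
      by blast
    \<comment> \<open>The ball of this radius around l lies inside s.\<close>
    then have "0 < e - p (l - x)" using Basis by simp
    then have "\<forall>\<^sub>F z in F. p (f z - l) < e - p (l - x)"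
      using r x nonneg [of p] by (metis order_tendstoD(2))
    then show ?case
      using f
    proof eventually_elim
      case (elim z)
      have "p ((f z - l) + (l - x)) \<le> p (f z - l) + p (l - x)"
        using elim r x by (intro triangle diff_closed) auto
      with elim show ?case by (simp add: s)
    qed
  qed simp
  with r show "limitin (seminorm_topology V P) f l F"
    by (simp add: limitin_def topspace) (simp add: seminorm_topology_def openin_topology_generated_by_iff)
qed

text \<open>The image filter of a Cauchy sequence is a Cauchy filter.\<close>

lemma complete_Cauchy_limit:
  fixes X :: "nat \<Rightarrow> 'v"
  assumes "seminorm_complete V P" and X: "\<And>n. X n \<in> V"
    and Cauchy: "\<And>p e. p \<in> P \<Longrightarrow> 0 < e \<Longrightarrow> \<exists>N. \<forall>m\<ge>N. \<forall>n\<ge>N. p (X m - X n) < e"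
  shows "\<exists>l. limitin (seminorm_topology V P) X l sequentially"
proof -
  let ?F = "filtermap X sequentially"
  have "?F \<noteq> bot" by (simp add: filtermap_bot_iff)
  moreover have "?F \<le> principal V"
    using X by (simp add: le_principal eventually_filtermap)
  moreover have "\<forall>\<^sub>F (x, y) in ?F \<times>\<^sub>F ?F. p (x - y) < e" if "p \<in> P" "0 < e" for p e
  proof -
    obtain N where N: "\<forall>m\<ge>N. \<forall>n\<ge>N. p (X m - X n) < e"
      using Cauchy [OF \<open>p \<in> P\<close> \<open>0 < e\<close>] by blast
    have "eventually (\<lambda>x. x \<in> X ` {N..}) ?F"
      unfolding eventually_filtermap by (rule eventually_sequentiallyI [of N]) simp
    with N show ?thesis
      unfolding eventually_prod_filter by (intro exI conjI) (assumption | auto)+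
  qed
  ultimately obtain l where "limitin (seminorm_topology V P) (\<lambda>x. x) l ?F"
    using assms(1) unfolding seminorm_complete_def by blast
  then have "limitin (seminorm_topology V P) X l sequentially"
    by (simp add: limitin_def eventually_filtermap)
  then show ?thesis by blast
qed

end

section \<open>Limits and series in a pro-C*-algebra\<close>

abbreviation continuous_seminorms :: "('a::pro_cstar_algebra \<Rightarrow> real) set"  ("\<S>")
  where "\<S> \<equiv> continuous_cstar_seminorms"

lemma cstar_seminormed: "p \<in> \<S> \<Longrightarrow> cstar_seminormed p"
  by (simp add: continuous_cstar_seminorms_def cstar_seminormed_def)

text \<open>By the reverse triangle inequality the members of a defining family are continuous, so
  the family lies in \<open>\<S>\<close>.\<close>

lemma pro_cstar_algebra_seminorms:
  obtains P :: "('a::pro_cstar_algebra \<Rightarrow> real) set"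
  where "P \<subseteq> \<S>" "seminorm_family UNIV P" "seminorm_complete UNIV P"
    "\<And>(f :: 'c \<Rightarrow> 'a) l F. (f \<longlongrightarrow> l) F \<longleftrightarrow> (\<forall>p\<in>P. ((\<lambda>x. p (f x - l)) \<longlongrightarrow> 0) F)"
proof -
  obtain P :: "('a \<Rightarrow> real) set" where P: "P \<noteq> {}" "\<forall>p\<in>P. cstar_seminorm p"
    and op: "\<forall>U. open U \<longleftrightarrow> openin (seminorm_topology UNIV P) U" and comp: "seminorm_complete UNIV P"
    using cstar_topology by metis
  have cs: "cstar_seminormed p" if "p \<in> P" for p
    using P that by (simp add: cstar_seminormed_def)
  interpret seminorm_family UNIV P
    by unfold_locales
      (use P cs in \<open>auto intro: cstar_seminormed.nonneg cstar_seminormed.zero cstar_seminormed.triangle\<close>)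
  have lim: "(f \<longlongrightarrow> l) F \<longleftrightarrow> (\<forall>p\<in>P. ((\<lambda>x. p (f x - l)) \<longlongrightarrow> 0) F)"
    for f :: "'d \<Rightarrow> 'a" and l F
  proof -
    have "(f \<longlongrightarrow> l) F \<longleftrightarrow> limitin (seminorm_topology UNIV P) f l F"
      using op by (auto simp: tendsto_def limitin_def topspace)
    then show ?thesis by (simp add: limitin_iff)
  qed
  have "P \<subseteq> \<S>"
  proof
    fix p
    assume p: "p \<in> P"
    then interpret cstar_seminormed p by (rule cs)
    have "(p \<longlongrightarrow> p x) (at x)" for x
    proof (rule LIM_zero_cancel, rule tendsto_rabs_zero_cancel, rule tendsto_zero_mono)
      have "((\<lambda>y. y) \<longlongrightarrow> x) (at x)" by (rule tendsto_ident_at)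
      then show "((\<lambda>y. p (y - x)) \<longlongrightarrow> 0) (at x)"
        using lim [of "\<lambda>y. y" x "at x"] p by simp
      show "\<bar>p y - p x\<bar> \<le> p (y - x)" for y
        using le_via [of x y] le_via [of y x] commute [of x y] by simp
    qed simp
    then have "continuous_on UNIV p"
      by (simp add: continuous_on_def)
    with P p show "p \<in> \<S>" by (simp add: continuous_cstar_seminorms_def)
  qed
  then show thesis
    using comp lim seminorm_family_axioms by (intro that)
qed

text \<open>Forward by continuity of each seminorm at 0, backward because \<open>\<S>\<close>
  contains a defining family.\<close>

lemma tendsto_iff_seminorms:
  fixes f :: "'c \<Rightarrow> 'a::pro_cstar_algebra"
  shows "(f \<longlongrightarrow> l) F \<longleftrightarrow> (\<forall>p\<in>\<S>. ((\<lambda>x. p (f x - l)) \<longlongrightarrow> 0) F)"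
proof -
  obtain P :: "('a \<Rightarrow> real) set" where P: "P \<subseteq> \<S>"
    and lim: "\<And>(f :: 'c \<Rightarrow> 'a) l F. (f \<longlongrightarrow> l) F \<longleftrightarrow> (\<forall>p\<in>P. ((\<lambda>x. p (f x - l)) \<longlongrightarrow> 0) F)"
    using pro_cstar_algebra_seminorms by metis
  show ?thesis
  proof
    assume "(f \<longlongrightarrow> l) F"
    then have *: "((\<lambda>x. f x - l) \<longlongrightarrow> 0) F"
      by (simp add: lim)
    show "\<forall>p\<in>\<S>. ((\<lambda>x. p (f x - l)) \<longlongrightarrow> 0) F"
    proof
      fix p :: "'a \<Rightarrow> real"
      assume p: "p \<in> \<S>"
      then have "continuous_on UNIV p"
        by (simp add: continuous_cstar_seminorms_def)
      then have "((\<lambda>x. p (f x - l)) \<longlongrightarrow> p 0) F"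
        by (rule continuous_on_tendsto_compose [OF _ *]) auto
      then show "((\<lambda>x. p (f x - l)) \<longlongrightarrow> 0) F"
        by (simp add: cstar_seminormed.zero [OF cstar_seminormed [OF p]])
    qed
  qed (use P lim in blast)
qed

text \<open>The constant sequence x converges to 0, and the topology is Hausdorff.\<close>

lemma seminorms_separate:
  fixes x :: "'a::pro_cstar_algebra"
  assumes "\<And>p. p \<in> \<S> \<Longrightarrow> p x = 0"
  shows "x = 0"
proof -
  have "(\<lambda>_::nat. p (x - 0)) \<longlonglongrightarrow> 0" if "p \<in> \<S>" for p
    using assms [OF that] by simp
  then have "(\<lambda>_::nat. x) \<longlonglongrightarrow> 0"
    unfolding tendsto_iff_seminorms by blast
  then show ?thesis
    by (simp add: LIMSEQ_const_iff)
qed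

lemma seminorms_nonempty: "(\<S> :: ('a::pro_cstar_algebra \<Rightarrow> real) set) \<noteq> {}"
proof -
  obtain P :: "('a \<Rightarrow> real) set" where "P \<subseteq> \<S>" "seminorm_family UNIV P"
    using pro_cstar_algebra_seminorms by metis
  then show ?thesis using seminorm_family.nonempty by blast
qed

lemma pro_cstar_Cauchy_convergent:
  fixes X :: "nat \<Rightarrow> 'a::pro_cstar_algebra"
  assumes "\<And>p e. p \<in> \<S> \<Longrightarrow> 0 < e \<Longrightarrow> \<exists>N. \<forall>m\<ge>N. \<forall>n\<ge>N. p (X m - X n) < e"
  shows "\<exists>l. X \<longlonglongrightarrow> l"
proof -
  obtain P :: "('a \<Rightarrow> real) set" where P: "P \<subseteq> \<S>" "seminorm_family UNIV P" "seminorm_complete UNIV P"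
    and lim: "\<And>(f :: nat \<Rightarrow> 'a) l F. (f \<longlongrightarrow> l) F \<longleftrightarrow> (\<forall>p\<in>P. ((\<lambda>x. p (f x - l)) \<longlongrightarrow> 0) F)"
    using pro_cstar_algebra_seminorms by metis
  interpret seminorm_family UNIV P by fact
  have "\<exists>l. limitin (seminorm_topology UNIV P) X l sequentially"
    using P assms by (intro complete_Cauchy_limit) auto
  then show ?thesis by (simp add: lim limitin_iff)
qed

lemma sum_diff_lessThan:
  fixes f :: "nat \<Rightarrow> 'b::ab_group_add"
  shows "m \<le> n \<Longrightarrow> sum f {..<n} - sum f {..<m} = sum f {m..<n}"
  by (simp add: lessThan_atLeast0 sum_diff_nat_ivl)

lemma summable_iff_seminorms:
  fixes f :: "nat \<Rightarrow> 'a::pro_cstar_algebra"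
  shows "summable f \<longleftrightarrow> (\<forall>p\<in>\<S>. \<forall>e>0. \<exists>N. \<forall>m\<ge>N. \<forall>n\<ge>m. p (sum f {m..<n}) < e)"
proof
  assume "summable f"
  then obtain s where s: "(\<lambda>n. sum f {..<n}) \<longlonglongrightarrow> s"
    by (auto simp: summable_def sums_def)
  show "\<forall>p\<in>\<S>. \<forall>e>0. \<exists>N. \<forall>m\<ge>N. \<forall>n\<ge>m. p (sum f {m..<n}) < e"
  proof (intro ballI allI impI)
    fix p :: "'a \<Rightarrow> real" and e :: real
    assume p: "p \<in> \<S>" and e: "0 < e"
    interpret cstar_seminormed p by (rule cstar_seminormed [OF p])
    have "(\<lambda>n. p (sum f {..<n} - s)) \<longlonglongrightarrow> 0"
      using s p by (simp add: tendsto_iff_seminorms)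
    from order_tendstoD(2) [OF this, of "e / 2"] e
    obtain N where N: "\<And>n. N \<le> n \<Longrightarrow> p (sum f {..<n} - s) < e / 2"
      by (auto simp: eventually_sequentially)
    have "p (sum f {m..<n}) < e" if "N \<le> m" "m \<le> n" for m n
    proof -
      have "sum f {m..<n} = (sum f {..<n} - s) - (sum f {..<m} - s)"
        using that by (simp add: sum_diff_lessThan [symmetric])
      then have "p (sum f {m..<n}) \<le> p (sum f {..<n} - s) + p (sum f {..<m} - s)"
        by (simp only: triangle_diff)
      with N [of m] N [of n] that show ?thesis by simp
    qed
    then show "\<exists>N. \<forall>m\<ge>N. \<forall>n\<ge>m. p (sum f {m..<n}) < e" by blast
  qed
next
  assume r: "\<forall>p\<in>\<S>. \<forall>e>0. \<exists>N. \<forall>m\<ge>N. \<forall>n\<ge>m. p (sum f {m..<n}) < e"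
  have "\<exists>l. (\<lambda>n. sum f {..<n}) \<longlonglongrightarrow> l"
  proof (rule pro_cstar_Cauchy_convergent)
    fix p :: "'a \<Rightarrow> real" and e :: real
    assume p: "p \<in> \<S>" and e: "0 < e"
    interpret cstar_seminormed p by (rule cstar_seminormed [OF p])
    obtain N where N: "\<And>m n. N \<le> m \<Longrightarrow> m \<le> n \<Longrightarrow> p (sum f {m..<n}) < e"
      using r p e by meson
    have "p (sum f {..<m} - sum f {..<n}) < e" if "N \<le> m" "N \<le> n" for m n
      using N [of m n] N [of n m] that commute [of "sum f {..<m}" "sum f {..<n}"]
      by (cases "m \<le> n") (simp_all add: sum_diff_lessThan)
    then show "\<exists>N. \<forall>m\<ge>N. \<forall>n\<ge>N. p (sum f {..<m} - sum f {..<n}) < e" by blast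
  qed
  then show "summable f" by (simp add: summable_def sums_def)
qed

text \<open>The bound for each seminorm is continuity of g. Instances are \<open>star\<close>,
  scalars and two-sided multiplication.\<close>

lemma sums_additive:
  fixes f :: "nat \<Rightarrow> 'a::pro_cstar_algebra" and g :: "'a \<Rightarrow> 'a"
  assumes f: "f sums s" and g: "\<And>x y. g (x + y) = g x + g y"
    and bound: "\<And>p. p \<in> \<S> \<Longrightarrow> \<exists>K. \<forall>x. p (g x) \<le> K * p x"
  shows "(\<lambda>n. g (f n)) sums g s"
proof -
  have g0: "g 0 = 0" using g [of 0 0] by simp
  have gd: "g (x - y) = g x - g y" for x y
    using g [of "x - y" y] by (simp add: algebra_simps)
  have gs: "g (\<Sum>i<n. f i) = (\<Sum>i<n. g (f i))" for n
    by (induction n) (simp_all add: g0 g)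
  show ?thesis
    unfolding sums_def tendsto_iff_seminorms
  proof
    fix p :: "'a \<Rightarrow> real"
    assume p: "p \<in> \<S>"
    interpret cstar_seminormed p by (rule cstar_seminormed [OF p])
    obtain K where K: "\<And>x. p (g x) \<le> K * p x" using bound [OF p] by blast
    have "(\<lambda>n. p ((\<Sum>i<n. f i) - s)) \<longlonglongrightarrow> 0"
      using f p by (simp add: sums_def tendsto_iff_seminorms)
    from tendsto_mult_right_zero [OF this, of K]
    show "(\<lambda>n. p ((\<Sum>i<n. g (f i)) - g s)) \<longlonglongrightarrow> 0"
      by (rule tendsto_zero_mono) (simp_all add: K flip: gs gd)
  qed
qed

lemma sums_star:
  fixes f :: "nat \<Rightarrow> 'a::pro_cstar_algebra"
  assumes "f sums s"
  shows "(\<lambda>n. star (f n)) sums star s"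
  by (rule sums_additive [OF assms star_add])
    (metis cstar_seminormed cstar_seminormed.star mult_1 order_refl)

context cstar_seminormed
begin

lemma sum_squares_mono:
  assumes "finite J" "I \<subseteq> J"
  shows "p (\<Sum>i\<in>I. star (a i) * a i) \<le> p (\<Sum>i\<in>J. star (a i) * a i)"
proof -
  have "(\<Sum>i\<in>J. star (a i) * a i) = (\<Sum>i\<in>I. star (a i) * a i) + (\<Sum>i\<in>J - I. star (a i) * a i)"
    using assms by (metis add.commute sum.subset_diff)
  then show ?thesis
    by (simp add: psd_mono psd_sum psd_star_square)
qed

lemma sum_cauchy_schwarz:
  "(p (\<Sum>i\<in>I. star (a i) * b i))\<^sup>2 \<le>
    p (\<Sum>i\<in>I. star (a i) * a i) * p (\<Sum>i\<in>I. star (b i) * b i)"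
proof (rule cauchy_schwarz)
  show "psd (\<Sum>i\<in>I. star (a i) * a i)"
    by (intro psd_sum psd_star_square)
next
  fix c
  have "star c * (\<Sum>i\<in>I. star (a i) * a i) * c - star c * (\<Sum>i\<in>I. star (a i) * b i) -
      star (\<Sum>i\<in>I. star (a i) * b i) * c + (\<Sum>i\<in>I. star (b i) * b i) =
      (\<Sum>i\<in>I. star (a i * c - b i) * (a i * c - b i))"
    by (simp add: star_sum star_simps sum_distrib_left sum_distrib_right sum.distrib sum_subtractf
        algebra_simps)
  then show "psd (star c * (\<Sum>i\<in>I. star (a i) * a i) * c - star c * (\<Sum>i\<in>I. star (a i) * b i) -
      star (\<Sum>i\<in>I. star (a i) * b i) * c + (\<Sum>i\<in>I. star (b i) * b i))"
    by (simp add: psd_sum psd_star_square)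
qed

text \<open>Parallelogram law: adding the positive sum of squared differences can only enlarge the
  seminorm. This makes \<open>\<H>\<^sub>A\<close> closed under addition.\<close>

lemma sum_squares_add_le:
  "p (\<Sum>i\<in>I. star (a i + b i) * (a i + b i)) \<le>
    2 * p (\<Sum>i\<in>I. star (a i) * a i) + 2 * p (\<Sum>i\<in>I. star (b i) * b i)"
proof -
  let ?d = "\<Sum>i\<in>I. star (a i - b i) * (a i - b i)"
  have "p (\<Sum>i\<in>I. star (a i + b i) * (a i + b i)) \<le> p ((\<Sum>i\<in>I. star (a i + b i) * (a i + b i)) + ?d)"
    by (intro psd_mono psd_sum psd_star_square)
  also have "(\<Sum>i\<in>I. star (a i + b i) * (a i + b i)) + ?d =
      2 *\<^sub>r ((\<Sum>i\<in>I. star (a i) * a i) + (\<Sum>i\<in>I. star (b i) * b i))"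
    using scaleC_add_left [of 1 1 "(\<Sum>i\<in>I. star (a i) * a i) + (\<Sum>i\<in>I. star (b i) * b i)"]
    by (simp add: scaleC_one star_simps sum.distrib sum_subtractf algebra_simps)
  also have "p \<dots> \<le> 2 * p (\<Sum>i\<in>I. star (a i) * a i) + 2 * p (\<Sum>i\<in>I. star (b i) * b i)"
    unfolding scaleC using triangle [of "\<Sum>i\<in>I. star (a i) * a i" "\<Sum>i\<in>I. star (b i) * b i"] by simp
  finally show ?thesis .
qed

end

lemma square_summable_add:
  fixes a b :: "nat \<Rightarrow> 'a::pro_cstar_algebra"
  assumes a: "summable (\<lambda>n. star (a n) * a n)" and b: "summable (\<lambda>n. star (b n) * b n)"
  shows "summable (\<lambda>n. star (a n + b n) * (a n + b n))"
  unfolding summable_iff_seminorms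
proof (intro ballI allI impI)
  fix p :: "'a \<Rightarrow> real" and e :: real
  assume p: "p \<in> \<S>" and e: "0 < e"
  interpret cstar_seminormed p by (rule cstar_seminormed [OF p])
  have "0 < e / 4" using e by simp
  then obtain M N where
    M: "\<And>m n. M \<le> m \<Longrightarrow> m \<le> n \<Longrightarrow> p (\<Sum>i=m..<n. star (a i) * a i) < e / 4" and
    N: "\<And>m n. N \<le> m \<Longrightarrow> m \<le> n \<Longrightarrow> p (\<Sum>i=m..<n. star (b i) * b i) < e / 4"
    using a b p unfolding summable_iff_seminorms by meson
  have "p (\<Sum>i=m..<n. star (a i + b i) * (a i + b i)) < e" if "max M N \<le> m" "m \<le> n" for m n
    using sum_squares_add_le [of a b "{m..<n}"] M [of m n] N [of m n] that by simp
  then show "\<exists>N. \<forall>m\<ge>N. \<forall>n\<ge>m. p (\<Sum>i=m..<n. star (a i + b i) * (a i + b i)) < e" by blast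
qed

lemma square_summable_mult:
  fixes a :: "nat \<Rightarrow> 'a::pro_cstar_algebra"
  assumes "summable (\<lambda>n. star (a n) * a n)"
  shows "summable (\<lambda>n. star (a n * c) * (a n * c))"
proof -
  from assms obtain s where "(\<lambda>n. star (a n) * a n) sums s" by (auto simp: summable_def)
  then have "(\<lambda>n. star c * (star (a n) * a n) * c) sums (star c * s * c)"
  proof (rule sums_additive)
    fix p :: "'a \<Rightarrow> real"
    assume "p \<in> \<S>"
    then interpret cstar_seminormed p by (rule cstar_seminormed)
    have "p (star c * x * c) \<le> p c * p x * p c" for x
      by (intro submult_le) (simp_all add: star)
    then show "\<exists>K. \<forall>x. p (star c * x * c) \<le> K * p x"
      by (intro exI [of _ "p c * p c"]) (simp add: mult.commute mult.left_commute)
  qed (simp add: algebra_simps)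
  then show ?thesis by (auto simp: summable_def star_simps mult.assoc)
qed

lemma square_summable_scaleC:
  fixes a :: "nat \<Rightarrow> 'a::pro_cstar_algebra"
  assumes "summable (\<lambda>n. star (a n) * a n)"
  shows "summable (\<lambda>n. star (c *\<^sub>C a n) * (c *\<^sub>C a n))"
proof -
  from assms obtain s where "(\<lambda>n. star (a n) * a n) sums s" by (auto simp: summable_def)
  then have "(\<lambda>n. (cnj c * c) *\<^sub>C (star (a n) * a n)) sums ((cnj c * c) *\<^sub>C s)"
    by (rule sums_additive [OF _ scaleC_add_right])
      (metis cstar_seminormed cstar_seminormed.scaleC order_refl)
  then show ?thesis
    by (auto simp: summable_def star_simps scaleC_mult_left scaleC_mult_right scaleC_scaleC mult.commute)
qed

section \<open>Hilbert modules and frames of multipliers\<close>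

lemma complex_subspace_diff:
  assumes V: "complex_subspace V" and x: "x \<in> V" and y: "y \<in> V"
  shows "x - y \<in> V"
proof -
  have "x + (- 1) *\<^sub>C y \<in> V"
    using assms unfolding complex_subspace_def by blast
  then show ?thesis by (simp add: scaleC_one)
qed

context pre_hilbert_module
begin

lemma zero_closed [simp]: "0 \<in> carrier E"
  and add_closed: "x \<in> carrier E \<Longrightarrow> y \<in> carrier E \<Longrightarrow> x + y \<in> carrier E"
  and scaleC_closed: "x \<in> carrier E \<Longrightarrow> c *\<^sub>C x \<in> carrier E"
  using subspace unfolding complex_subspace_def by auto

lemma diff_closed: "x \<in> carrier E \<Longrightarrow> y \<in> carrier E \<Longrightarrow> x - y \<in> carrier E"
  by (rule complex_subspace_diff [OF subspace])

lemma sum_closed: "(\<And>i. i \<in> I \<Longrightarrow> f i \<in> carrier E) \<Longrightarrow> (\<Sum>i\<in>I. f i) \<in> carrier E"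
  by (induction I rule: infinite_finite_induct) (auto intro: add_closed)

lemma ip_diff_right:
  assumes "x \<in> carrier E" "y \<in> carrier E" "z \<in> carrier E"
  shows "ip E x (y - z) = ip E x y - ip E x z"
  using ip_add_right [of x "y - z" z] assms by (simp add: diff_closed algebra_simps)

lemma ip_zero_right: "x \<in> carrier E \<Longrightarrow> ip E x 0 = 0"
  using ip_diff_right [of x 0 0] by simp

lemma ip_sum_right:
  "x \<in> carrier E \<Longrightarrow> (\<And>i. i \<in> I \<Longrightarrow> f i \<in> carrier E) \<Longrightarrow>
    ip E x (\<Sum>i\<in>I. f i) = (\<Sum>i\<in>I. ip E x (f i))"
  by (induction I rule: infinite_finite_induct)
    (auto simp: ip_zero_right ip_add_right sum_closed)

lemma ip_add_left:
  assumes "x \<in> carrier E" "y \<in> carrier E" "z \<in> carrier E"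
  shows "ip E (x + y) z = ip E x z + ip E y z"
  using ip_add_right [of z x y, THEN arg_cong [where f = star]] assms
  by (simp add: star_add ip_star add_closed)

lemma ip_diff_left:
  assumes "x \<in> carrier E" "y \<in> carrier E" "z \<in> carrier E"
  shows "ip E (x - y) z = ip E x z - ip E y z"
  using ip_diff_right [of z x y, THEN arg_cong [where f = star]] assms
  by (simp add: star_diff ip_star diff_closed)

lemma ip_act_left: "x \<in> carrier E \<Longrightarrow> y \<in> carrier E \<Longrightarrow> ip E (act E x a) y = star a * ip E x y"
  using ip_act_right [of y x a, THEN arg_cong [where f = star]]
  by (simp add: star_mult ip_star act_closed)

lemma ip_scaleC_left: "x \<in> carrier E \<Longrightarrow> y \<in> carrier E \<Longrightarrow> ip E (c *\<^sub>C x) y = cnj c *\<^sub>C ip E x y"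
  using ip_scaleC_right [of y x c, THEN arg_cong [where f = star]]
  by (simp add: star_scaleC ip_star scaleC_closed)

lemma eqI_ip:
  assumes "x \<in> carrier E" "y \<in> carrier E" "\<And>z. z \<in> carrier E \<Longrightarrow> ip E z x = ip E z y"
  shows "x = y"
proof -
  have "ip E (x - y) (x - y) = 0"
    using assms by (simp add: ip_diff_right diff_closed)
  then show ?thesis
    using assms by (simp add: ip_definite diff_closed)
qed

text \<open>Adjoints agree on the carrier of \<open>F\<close> by definiteness in \<open>E\<close>,
  and off it because both are extensional. \<open>F\<close> is any module record, so
  \<open>\<H>\<^sub>A\<close> can be inserted directly.\<close>

lemma is_module_adjoint_unique:
  assumes S: "is_module_adjoint E F T S" and S': "is_module_adjoint E F T S'"
  shows "S = S'"
proof
  fix y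
  show "S y = S' y"
  proof (cases "y \<in> carrier F")
    case True
    have "S y \<in> carrier E" "S' y \<in> carrier E"
      using S S' True by (auto simp: is_module_adjoint_def module_morphisms_def)
    then show ?thesis
      using S S' True by (intro eqI_ip) (auto simp: is_module_adjoint_def)
  next
    case False
    have "S \<in> carrier F \<rightarrow>\<^sub>E carrier E" "S' \<in> carrier F \<rightarrow>\<^sub>E carrier E"
      using S S' by (simp_all add: is_module_adjoint_def module_morphisms_def)
    then show ?thesis
      by (simp only: PiE_arb [OF _ False])
  qed
qed

lemma module_adjoint_eq:
  assumes "is_module_adjoint E F T S"
  shows "module_adjoint E F T = S"
  unfolding module_adjoint_def
  by (rule the_equality, fact) (rule is_module_adjoint_unique [OF _ assms])

lemma ip_psd: "cstar_seminormed p \<Longrightarrow> x \<in> carrier E \<Longrightarrow> cstar_seminormed.psd p (ip E x x)"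
  using ip_positive [of x] by (auto simp: cstar_positive_def cstar_seminormed.psd_star_square)

lemma ip_cauchy_schwarz:
  assumes p: "cstar_seminormed p" and x: "x \<in> carrier E" and y: "y \<in> carrier E"
  shows "(p (ip E x y))\<^sup>2 \<le> p (ip E x x) * p (ip E y y)"
proof -
  interpret cstar_seminormed p by (rule p)
  show ?thesis
  proof (rule cauchy_schwarz [OF ip_psd [OF p x]])
    fix a
    have "ip E (act E x a - y) (act E x a - y) =
        star a * ip E x x * a - star a * ip E x y - star (ip E x y) * a + ip E y y"
      using x y by (simp add: ip_diff_left ip_diff_right ip_act_left ip_act_right act_closed
          diff_closed ip_star algebra_simps)
    then show "psd (star a * ip E x x * a - star a * ip E x y - star (ip E x y) * a + ip E y y)"
      using ip_psd [OF p, of "act E x a - y"] x y by (simp add: act_closed diff_closed)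
  qed
qed

lemma module_seminorm_nonneg: "cstar_seminormed p \<Longrightarrow> 0 \<le> module_seminorm E p x"
  by (simp add: module_seminorm_def cstar_seminormed.nonneg)

lemma ip_bound:
  assumes "cstar_seminormed p" "x \<in> carrier E" "y \<in> carrier E"
  shows "p (ip E x y) \<le> module_seminorm E p x * module_seminorm E p y"
  using real_le_rsqrt [OF ip_cauchy_schwarz [OF assms]]
  by (simp add: module_seminorm_def real_sqrt_mult)

lemma module_seminorm_zero: "cstar_seminormed p \<Longrightarrow> module_seminorm E p 0 = 0"
  by (simp add: module_seminorm_def ip_zero_right cstar_seminormed.zero)

lemma module_seminorm_square: "cstar_seminormed p \<Longrightarrow> (module_seminorm E p x)\<^sup>2 = p (ip E x x)"
  by (simp add: module_seminorm_def cstar_seminormed.nonneg)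

lemma module_seminorm_triangle:
  assumes p: "cstar_seminormed p" and x: "x \<in> carrier E" and y: "y \<in> carrier E"
  shows "module_seminorm E p (x + y) \<le> module_seminorm E p x + module_seminorm E p y"
proof (rule power2_le_imp_le)
  interpret cstar_seminormed p by (rule p)
  have "ip E (x + y) (x + y) = ip E x x + ip E x y + ip E y x + ip E y y"
    using x y by (simp add: ip_add_left ip_add_right add_closed algebra_simps)
  then have "p (ip E (x + y) (x + y)) \<le> p (ip E x x) + p (ip E x y) + p (ip E y x) + p (ip E y y)"
    by (simp only:) (intro order_trans [OF triangle] add_mono order_refl)
  also have "\<dots> \<le> (module_seminorm E p x + module_seminorm E p y)\<^sup>2"
    using ip_bound [OF p x y] ip_bound [OF p y x]
    by (simp add: module_seminorm_square [OF p, symmetric] power2_eq_square algebra_simps)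
  finally show "(module_seminorm E p (x + y))\<^sup>2 \<le> (module_seminorm E p x + module_seminorm E p y)\<^sup>2"
    by (simp add: module_seminorm_square p)
qed (simp add: module_seminorm_nonneg p)

sublocale module_family: seminorm_family "carrier E" "module_seminorms E"
proof
  show "module_seminorms E \<noteq> {}"
    by (simp add: module_seminorms_def seminorms_nonempty)
  show "x - y \<in> carrier E" if "x \<in> carrier E" "y \<in> carrier E" for x y
    using that by (rule diff_closed)
  fix q
  assume "q \<in> module_seminorms E"
  then obtain p where q: "q = module_seminorm E p" and "p \<in> \<S>"
    by (auto simp: module_seminorms_def)
  then have p: "cstar_seminormed p" by (simp add: cstar_seminormed)
  show "0 \<le> q x" for x
    unfolding q by (rule module_seminorm_nonneg [OF p])
  show "q 0 = 0"
    unfolding q by (rule module_seminorm_zero [OF p])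
  show "q (x + y) \<le> q x + q y" if "x \<in> carrier E" "y \<in> carrier E" for x y
    unfolding q using that by (rule module_seminorm_triangle [OF p])
qed

lemma limitin_module_closed: "limitin (module_topology E) X l F \<Longrightarrow> l \<in> carrier E"
  by (simp add: limitin_def module_topology_def module_family.topspace)

lemma limitin_module_iff:
  assumes "\<And>n. X n \<in> carrier E"
  shows "limitin (module_topology E) X l F \<longleftrightarrow>
    l \<in> carrier E \<and> (\<forall>p\<in>\<S>. ((\<lambda>n. module_seminorm E p (X n - l)) \<longlongrightarrow> 0) F)"
proof -
  have "\<forall>\<^sub>F n in F. X n \<in> carrier E" using assms by simp
  from module_family.limitin_iff [OF this] show ?thesis
    by (simp add: module_seminorms_def module_topology_def)
qed

lemma limitin_additive:
  assumes X: "\<And>n. X n \<in> carrier E" and lim: "limitin (module_topology E) X l F"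
    and g: "\<And>x. x \<in> carrier E \<Longrightarrow> g x \<in> carrier E"
      "\<And>x y. x \<in> carrier E \<Longrightarrow> y \<in> carrier E \<Longrightarrow> g (x + y) = g x + g y"
    and bound: "\<And>p. p \<in> \<S> \<Longrightarrow> \<exists>K. \<forall>x\<in>carrier E. module_seminorm E p (g x) \<le> K * module_seminorm E p x"
  shows "limitin (module_topology E) (\<lambda>n. g (X n)) (g l) F"
  unfolding limitin_module_iff [where X = "\<lambda>n. g (X n)", OF g(1) [OF X]]
proof (intro conjI ballI)
  have l: "l \<in> carrier E" using lim by (rule limitin_module_closed)
  then show "g l \<in> carrier E" by (rule g)
  have gd: "g (X n - l) = g (X n) - g l" for n
    using g(2) [of "X n - l" l] X l by (simp add: diff_closed algebra_simps)
  fix p :: "'a \<Rightarrow> real"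
  assume p: "p \<in> \<S>"
  then obtain K where K: "\<And>x. x \<in> carrier E \<Longrightarrow> module_seminorm E p (g x) \<le> K * module_seminorm E p x"
    using bound by blast
  have "((\<lambda>n. module_seminorm E p (X n - l)) \<longlongrightarrow> 0) F"
    using lim p by (auto simp: limitin_module_iff [OF X])
  from tendsto_mult_right_zero [OF this, of K]
  show "((\<lambda>n. module_seminorm E p (g (X n) - g l)) \<longlongrightarrow> 0) F"
    by (rule tendsto_zero_mono)
      (simp_all add: K X l diff_closed module_seminorm_nonneg cstar_seminormed p flip: gd)
qed

lemma limitin_module_add:
  assumes "\<And>n. X n \<in> carrier E" "limitin (module_topology E) X l F"
    and "\<And>n. Y n \<in> carrier E" "limitin (module_topology E) Y m F"
  shows "limitin (module_topology E) (\<lambda>n. X n + Y n) (l + m) F"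
proof -
  have XY: "X n + Y n \<in> carrier E" for n
    using assms by (simp add: add_closed)
  show ?thesis
    unfolding limitin_module_iff [where X = "\<lambda>n. X n + Y n", OF XY]
  proof (intro conjI ballI)
    have l: "l \<in> carrier E" "m \<in> carrier E" using assms(2,4) by (auto dest: limitin_module_closed)
    then show "l + m \<in> carrier E" by (rule add_closed)
    fix p :: "'a \<Rightarrow> real"
    assume p: "p \<in> \<S>"
    have "((\<lambda>n. module_seminorm E p (X n - l)) \<longlongrightarrow> 0) F" "((\<lambda>n. module_seminorm E p (Y n - m)) \<longlongrightarrow> 0) F"
      using assms(2,4) p by (auto simp: limitin_module_iff [OF assms(1)] limitin_module_iff [OF assms(3)])
    from tendsto_add_zero [OF this]
    show "((\<lambda>n. module_seminorm E p (X n + Y n - (l + m))) \<longlongrightarrow> 0) F"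
    proof (rule tendsto_zero_mono)
      show "module_seminorm E p (X n + Y n - (l + m)) \<le>
          module_seminorm E p (X n - l) + module_seminorm E p (Y n - m)" for n
        using module_seminorm_triangle [of p "X n - l" "Y n - m"] assms l p
        by (simp add: cstar_seminormed diff_closed algebra_simps)
    qed (simp add: module_seminorm_nonneg cstar_seminormed p)
  qed
qed

text \<open>Cauchy-Schwarz makes the pairing with y continuous; this turns limits in the module into
  limits in the algebra.\<close>

lemma limitin_ip:
  assumes X: "\<And>n. X n \<in> carrier E" and lim: "limitin (module_topology E) X l F" and y: "y \<in> carrier E"
  shows "((\<lambda>n. ip E y (X n)) \<longlongrightarrow> ip E y l) F"
  unfolding tendsto_iff_seminorms
proof
  fix p :: "'a \<Rightarrow> real"
  assume p: "p \<in> \<S>"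
  have l: "l \<in> carrier E" using lim by (rule limitin_module_closed)
  have "((\<lambda>n. module_seminorm E p (X n - l)) \<longlongrightarrow> 0) F"
    using lim p by (auto simp: limitin_module_iff [OF X])
  from tendsto_mult_right_zero [OF this, of "module_seminorm E p y"]
  show "((\<lambda>n. p (ip E y (X n) - ip E y l)) \<longlongrightarrow> 0) F"
    by (rule tendsto_zero_mono)
      (simp_all add: ip_bound X l y diff_closed cstar_seminormed p cstar_seminormed.nonneg flip: ip_diff_right)
qed

lemma limitin_module_unique:
  assumes X: "\<And>n::nat. X n \<in> carrier E"
    and "limitin (module_topology E) X l sequentially" "limitin (module_topology E) X m sequentially"
  shows "l = m"
proof (rule eqI_ip)
  show "l \<in> carrier E" "m \<in> carrier E" using assms(2,3) by (auto dest: limitin_module_closed)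
  show "ip E z l = ip E z m" if "z \<in> carrier E" for z
    using assms that by (intro LIMSEQ_unique [OF limitin_ip limitin_ip])
qed

end

section \<open>Morphisms, the modules \<open>\<A>\<close> and \<open>\<H>\<^sub>A\<close>, and
  multipliers\<close>

lemma module_morphismD:
  assumes "T \<in> module_morphisms E F"
  shows "x \<in> carrier E \<Longrightarrow> T x \<in> carrier F"
    and "x \<in> carrier E \<Longrightarrow> y \<in> carrier E \<Longrightarrow> T (x + y) = T x + T y"
    and "x \<in> carrier E \<Longrightarrow> T (c *\<^sub>C x) = c *\<^sub>C T x"
    and "x \<in> carrier E \<Longrightarrow> T (act E x a) = act F (T x) a"
  using assms by (auto simp: module_morphisms_def)

lemma algebra_module_simps [simp]:
  "carrier \<A> = UNIV" "act \<A> a b = a * b" "ip \<A> a b = star a * b"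
  by (simp_all add: algebra_module_def)

lemma sequence_module_simps [simp]:
  "carrier \<H>\<^sub>A = {a. summable (\<lambda>n. star (a n) * a n)}" "act \<H>\<^sub>A a c = (\<lambda>n. a n * c)"
  "ip \<H>\<^sub>A a b = (\<Sum>n. star (a n) * b n)"
  by (simp_all add: sequence_module_def)

lemma star_mult_eq_zero_iff: "star a * a = 0 \<longleftrightarrow> (a :: 'a::pro_cstar_algebra) = 0"
proof
  assume "star a * a = 0"
  then have "p a = 0" if "p \<in> \<S>" for p
    using cstar_seminormed [OF that] by (metis cstar_seminormed.cstar cstar_seminormed.zero power2_eq_iff_nonneg
      zero_eq_power2)
  then show "a = 0" by (rule seminorms_separate)
qed simp

lemma pre_hilbert_algebra_module: "pre_hilbert_module (\<A> :: ('a::pro_cstar_algebra, 'a) cmodule)"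
  by unfold_locales
    (auto simp: complex_subspace_def scaleC_mult_left scaleC_mult_right star_simps algebra_simps
      cstar_positive_def star_mult_eq_zero_iff)

text \<open>Since \<open>\<A>\<close> is a pre-Hilbert module, adjoints are unique and the
  description behind \<open>multiplier_ip\<close> denotes one.\<close>

lemma multiplier_adjoint:
  assumes "g \<in> multipliers E"
  shows "is_module_adjoint \<A> E g (multiplier_ip E g)"
proof -
  obtain S where "is_module_adjoint \<A> E g S"
    using assms by (auto simp: multipliers_def adjointable_def)
  then show ?thesis
    using pre_hilbert_module.module_adjoint_eq [OF pre_hilbert_algebra_module]
    by (metis multiplier_ip_def ext)
qed

lemma multiplier_closed: "g \<in> multipliers E \<Longrightarrow> g a \<in> carrier E"
  by (auto simp: multipliers_def adjointable_def dest: module_morphismD(1))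

lemma multiplier_morphism: "g \<in> multipliers E \<Longrightarrow> g \<in> module_morphisms \<A> E"
  by (simp add: multipliers_def adjointable_def)

lemma ip_multiplier_left:
  "g \<in> multipliers E \<Longrightarrow> x \<in> carrier E \<Longrightarrow> ip E (g a) x = star a * multiplier_ip E g x"
  using multiplier_adjoint [of g E] by (simp add: is_module_adjoint_def)

lemma (in pre_hilbert_module) ip_multiplier_right:
  "g \<in> multipliers E \<Longrightarrow> x \<in> carrier E \<Longrightarrow> ip E x (g a) = star (multiplier_ip E g x) * a"
  using ip_multiplier_left [of g E x a, THEN arg_cong [where f = star]]
  by (simp add: star_simps ip_star multiplier_closed)

section \<open>Synthesis operators and dual frames\<close>

context hilbert_module
begin

lemma standard_frame_multiplier: "standard_frame E h \<Longrightarrow> h n \<in> multipliers E"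
  by (simp add: standard_frame_def)

lemma partial_sum_closed: "standard_frame E h \<Longrightarrow> (\<Sum>n\<in>I. h n (a n)) \<in> carrier E"
  by (intro sum_closed multiplier_closed standard_frame_multiplier)

lemma ip_partial_sum:
  "standard_frame E h \<Longrightarrow> x \<in> carrier E \<Longrightarrow>
    ip E x (\<Sum>n\<in>I. h n (a n)) = (\<Sum>n\<in>I. star (multiplier_ip E (h n) x) * a n)"
  by (simp add: ip_sum_right ip_multiplier_right multiplier_closed standard_frame_multiplier)

text \<open>Monotonicity of the seminorms on positive elements turns the upper frame inequality into
  numerical bounds, with one D for all p, x and I.\<close>

lemma frame_bessel:
  assumes "standard_frame E h"
  shows "\<exists>D>0. \<forall>p\<in>\<S>. \<forall>x\<in>carrier E. \<forall>I. finite I \<longrightarrow>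
    p (\<Sum>n\<in>I. star (multiplier_ip E (h n) x) * multiplier_ip E (h n) x) \<le> D * p (ip E x x)"
proof -
  obtain D where D: "0 < D" and le: "\<And>x. x \<in> carrier E \<Longrightarrow>
      (\<Sum>n. star (multiplier_ip E (h n) x) * multiplier_ip E (h n) x) \<le>\<^sub>A D *\<^sub>r ip E x x"
    using assms unfolding standard_frame_def by blast
  show ?thesis
  proof (intro exI [of _ D] conjI D ballI allI impI)
    fix p :: "'a \<Rightarrow> real" and x and I :: "nat set"
    assume p: "p \<in> \<S>" and x: "x \<in> carrier E" and I: "finite I"
    interpret cstar_seminormed p by (rule cstar_seminormed [OF p])
    let ?f = "\<lambda>n. star (multiplier_ip E (h n) x) * multiplier_ip E (h n) x"
    obtain d where d: "D *\<^sub>r ip E x x - suminf ?f = star d * d"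
      using le [OF x] by (auto simp: cstar_le_def cstar_positive_def)
    have "summable ?f" using assms x by (simp add: standard_frame_def)
    then have "(\<lambda>N. sum ?f {..<N}) \<longlonglongrightarrow> suminf ?f"
      using summable_sums sums_def by blast
    then have lim: "(\<lambda>N. p (sum ?f {..<N} - suminf ?f)) \<longlonglongrightarrow> 0"
      using p by (simp add: tendsto_iff_seminorms)
    have "p (sum ?f I) \<le> p (D *\<^sub>r ip E x x)"
    proof (rule field_le_epsilon)
      fix e :: real
      assume "0 < e"
      from order_tendstoD(2) [OF lim this] obtain N
        where N: "\<And>n. N \<le> n \<Longrightarrow> p (sum ?f {..<n} - suminf ?f) < e"
        by (auto simp: eventually_sequentially)
      obtain m where m: "I \<subseteq> {..<m}" using I finite_nat_iff_bounded by blast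
      let ?n = "max m N"
      have "p (sum ?f I) \<le> p (sum ?f {..<?n})"
        using m by (intro sum_squares_mono) auto
      \<comment> \<open>\<open>star d * d\<close> is the gap between the full sum and its upper
        bound; added to a partial sum it gives that bound up to a tail smaller than e.\<close>
      also have "\<dots> \<le> p (sum ?f {..<?n} + star d * d)"
        by (intro psd_mono psd_sum psd_star_square)
      also have "sum ?f {..<?n} + star d * d = D *\<^sub>r ip E x x + (sum ?f {..<?n} - suminf ?f)"
        by (simp flip: d)
      also have "p \<dots> \<le> p (D *\<^sub>r ip E x x) + e"
        using triangle [of "D *\<^sub>r ip E x x" "sum ?f {..<?n} - suminf ?f"] N [of ?n] by simp
      finally show "p (sum ?f I) \<le> p (D *\<^sub>r ip E x x) + e" .
    qed
    then show "p (sum ?f I) \<le> D * p (ip E x x)"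
      using D by (simp add: scaleC)
  qed
qed

lemma partial_sum_bound:
  assumes h: "standard_frame E h"
  obtains D where "0 < D"
    "\<And>p a I. p \<in> \<S> \<Longrightarrow> finite I \<Longrightarrow>
      (module_seminorm E p (\<Sum>n\<in>I. h n (a n)))\<^sup>2 \<le> D * p (\<Sum>n\<in>I. star (a n) * a n)"
proof -
  obtain D where D: "0 < D" and bessel: "\<forall>p\<in>\<S>. \<forall>x\<in>carrier E. \<forall>I. finite I \<longrightarrow>
      p (\<Sum>n\<in>I. star (multiplier_ip E (h n) x) * multiplier_ip E (h n) x) \<le> D * p (ip E x x)"
    using frame_bessel [OF h] by (elim exE conjE) (rule that)
  show thesis
  proof (rule that [OF D])
    fix p :: "'a \<Rightarrow> real" and a and I :: "nat set"
    assume p: "p \<in> \<S>" and I: "finite I"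
    interpret cstar_seminormed p by (rule cstar_seminormed [OF p])
    let ?u = "\<Sum>n\<in>I. h n (a n)" and ?s = "p (\<Sum>n\<in>I. star (a n) * a n)"
    have u: "?u \<in> carrier E" by (rule partial_sum_closed [OF h])
    have "(p (ip E ?u ?u))\<^sup>2 \<le>
        p (\<Sum>n\<in>I. star (multiplier_ip E (h n) ?u) * multiplier_ip E (h n) ?u) * ?s"
      using sum_cauchy_schwarz [of "\<lambda>n. multiplier_ip E (h n) ?u" a I]
      by (simp only: ip_partial_sum [OF h u])
    also have "\<dots> \<le> D * p (ip E ?u ?u) * ?s"
      by (intro mult_right_mono bessel [rule_format] p u I nonneg)
    finally have "p (ip E ?u ?u) * p (ip E ?u ?u) \<le> D * ?s * p (ip E ?u ?u)"
      by (simp add: power2_eq_square mult.assoc mult.left_commute mult.commute)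
    \<comment> \<open>One factor cancels; if it is 0 the bound is immediate.\<close>
    then have "p (ip E ?u ?u) \<le> D * ?s"
      using nonneg [of "ip E ?u ?u"] D by (cases "p (ip E ?u ?u) = 0") (simp_all add: mult_le_cancel_right)
    then show "(module_seminorm E p ?u)\<^sup>2 \<le> D * ?s"
      by (simp add: module_seminorm_square cstar_seminormed p)
  qed
qed

lemma synthesis_converges:
  assumes h: "standard_frame E h" and a: "summable (\<lambda>n. star (a n) * a n)"
  shows "\<exists>x. limitin (module_topology E) (\<lambda>N. \<Sum>n<N. h n (a n)) x sequentially"
  unfolding module_topology_def
proof (rule module_family.complete_Cauchy_limit [OF complete partial_sum_closed [OF h]])
  fix q :: "_ \<Rightarrow> real" and e :: real
  assume "q \<in> module_seminorms E" and e: "0 < e"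
  then obtain p where q: "q = module_seminorm E p" and p: "p \<in> \<S>"
    by (auto simp: module_seminorms_def)
  interpret cstar_seminormed p by (rule cstar_seminormed [OF p])
  obtain D where D: "0 < D" and bound: "\<And>a I. finite I \<Longrightarrow>
      (module_seminorm E p (\<Sum>n\<in>I. h n (a n)))\<^sup>2 \<le> D * p (\<Sum>n\<in>I. star (a n) * a n)"
    using partial_sum_bound [OF h] p by metis
  \<comment> \<open>\<open>partial_sum_bound\<close> controls the square of the module seminorm by D
    times the seminorm of a block.\<close>
  have "0 < e\<^sup>2 / D" using e D by simp
  then obtain N where N: "\<And>m n. N \<le> m \<Longrightarrow> m \<le> n \<Longrightarrow> p (\<Sum>i=m..<n. star (a i) * a i) < e\<^sup>2 / D"
    using a p unfolding summable_iff_seminorms by meson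
  have small: "q (\<Sum>i=m..<n. h i (a i)) < e" if "N \<le> m" "m \<le> n" for m n
  proof -
    have "(q (\<Sum>i=m..<n. h i (a i)))\<^sup>2 < e\<^sup>2"
      using bound [of "{m..<n}" a] N [OF that] D by (simp add: q less_divide_eq mult.commute)
    then show ?thesis using e by (simp add: power_less_imp_less_base)
  qed
  have q_minus: "q (x - y) = q (y - x)" if "x \<in> carrier E" "y \<in> carrier E" for x y
    using that by (simp add: q module_seminorm_def ip_diff_left ip_diff_right diff_closed algebra_simps)
  have "q ((\<Sum>i<m. h i (a i)) - (\<Sum>i<n. h i (a i))) < e" if "N \<le> m" "N \<le> n" for m n
  proof (cases "n \<le> m")
    case True
    with small [of n m] that show ?thesis by (simp add: sum_diff_lessThan)
  next
    case False
    then show ?thesis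
      using small [of m n] that by (subst q_minus) (simp_all add: sum_diff_lessThan partial_sum_closed [OF h])
  qed
  then show "\<exists>N. \<forall>m\<ge>N. \<forall>n\<ge>N. q ((\<Sum>i<m. h i (a i)) - (\<Sum>i<n. h i (a i))) < e" by blast
qed

text \<open>Restricted to the carrier because module morphisms are extensional.\<close>

definition synthesis :: "(nat \<Rightarrow> 'a \<Rightarrow> 'b) \<Rightarrow> (nat \<Rightarrow> 'a) \<Rightarrow> 'b"
  where "synthesis h = (\<lambda>a\<in>carrier \<H>\<^sub>A. THE x.
    limitin (module_topology E) (\<lambda>N. \<Sum>n<N. h n (a n)) x sequentially)"

lemma synthesis_eqI:
  assumes h: "standard_frame E h" and a: "a \<in> carrier \<H>\<^sub>A"
    and "limitin (module_topology E) (\<lambda>N. \<Sum>n<N. h n (a n)) x sequentially"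
  shows "synthesis h a = x"
proof -
  have closed: "(\<Sum>n<N. h n (a n)) \<in> carrier E" for N
    by (rule partial_sum_closed [OF h])
  have "(THE x. limitin (module_topology E) (\<lambda>N. \<Sum>n<N. h n (a n)) x sequentially) = x"
    by (rule the_equality, fact) (rule limitin_module_unique [OF closed _ assms(3)])
  with a show ?thesis by (simp add: synthesis_def)
qed

lemma limitin_synthesis:
  assumes h: "standard_frame E h" and a: "a \<in> carrier \<H>\<^sub>A"
  shows "limitin (module_topology E) (\<lambda>N. \<Sum>n<N. h n (a n)) (synthesis h a) sequentially"
proof -
  obtain x where x: "limitin (module_topology E) (\<lambda>N. \<Sum>n<N. h n (a n)) x sequentially"
    using synthesis_converges [OF h] a by auto
  then show ?thesis by (simp only: synthesis_eqI [OF h a x])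
qed

lemma synthesis_closed: "standard_frame E h \<Longrightarrow> a \<in> carrier \<H>\<^sub>A \<Longrightarrow> synthesis h a \<in> carrier E"
  by (rule limitin_module_closed [OF limitin_synthesis])

lemma synthesis_morphism:
  assumes h: "standard_frame E h"
  shows "synthesis h \<in> module_morphisms \<H>\<^sub>A E"
  unfolding module_morphisms_def
proof (intro CollectI conjI ballI allI)
  show "synthesis h \<in> carrier \<H>\<^sub>A \<rightarrow>\<^sub>E carrier E"
    using synthesis_closed [OF h] by (auto simp: synthesis_def)
next
  fix a b :: "nat \<Rightarrow> 'a"
  assume a: "a \<in> carrier \<H>\<^sub>A" and b: "b \<in> carrier \<H>\<^sub>A"
  show "synthesis h (a + b) = synthesis h a + synthesis h b"
  proof (rule synthesis_eqI [OF h])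
    show "a + b \<in> carrier \<H>\<^sub>A"
      using a b by (simp add: square_summable_add)
    have "(\<Sum>n<N. h n ((a + b) n)) = (\<Sum>n<N. h n (a n)) + (\<Sum>n<N. h n (b n))" for N
      using module_morphismD(2) [OF multiplier_morphism [OF standard_frame_multiplier [OF h]]]
      by (simp add: sum.distrib)
    then show "limitin (module_topology E) (\<lambda>N. \<Sum>n<N. h n ((a + b) n)) (synthesis h a + synthesis h b) sequentially"
      using limitin_module_add [OF partial_sum_closed [OF h] limitin_synthesis [OF h a]
          partial_sum_closed [OF h] limitin_synthesis [OF h b]] by simp
  qed
next
  fix c and a :: "nat \<Rightarrow> 'a"
  assume a: "a \<in> carrier \<H>\<^sub>A"
  show "synthesis h (c *\<^sub>C a) = c *\<^sub>C synthesis h a"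
  proof (rule synthesis_eqI [OF h])
    show "c *\<^sub>C a \<in> carrier \<H>\<^sub>A"
      using a by (simp add: square_summable_scaleC scaleC_fun_def)
    have "(\<Sum>n<N. h n ((c *\<^sub>C a) n)) = c *\<^sub>C (\<Sum>n<N. h n (a n))" for N
      using module_morphismD(3) [OF multiplier_morphism [OF standard_frame_multiplier [OF h]]]
      by (simp add: scaleC_sum_right scaleC_fun_def)
    moreover have "limitin (module_topology E) (\<lambda>N. c *\<^sub>C (\<Sum>n<N. h n (a n))) (c *\<^sub>C synthesis h a) sequentially"
    proof (rule limitin_additive [OF partial_sum_closed [OF h] limitin_synthesis [OF h a]])
      fix p :: "'a \<Rightarrow> real"
      assume "p \<in> \<S>"
      then interpret cstar_seminormed p by (rule cstar_seminormed)
      have "module_seminorm E p (c *\<^sub>C x) = cmod c * module_seminorm E p x" if "x \<in> carrier E" for x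
        using that by (simp add: module_seminorm_def ip_scaleC_left ip_scaleC_right scaleC_closed
            scaleC real_sqrt_mult)
      then show "\<exists>K. \<forall>x\<in>carrier E. module_seminorm E p (c *\<^sub>C x) \<le> K * module_seminorm E p x"
        by (intro exI [of _ "cmod c"]) simp
    qed (simp_all add: scaleC_closed scaleC_add_right)
    ultimately show "limitin (module_topology E) (\<lambda>N. \<Sum>n<N. h n ((c *\<^sub>C a) n)) (c *\<^sub>C synthesis h a) sequentially"
      by simp
  qed
next
  fix a :: "nat \<Rightarrow> 'a" and c
  assume a: "a \<in> carrier \<H>\<^sub>A"
  show "synthesis h (act \<H>\<^sub>A a c) = act E (synthesis h a) c"
  proof (rule synthesis_eqI [OF h])
    show "act \<H>\<^sub>A a c \<in> carrier \<H>\<^sub>A"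
      using a by (simp add: square_summable_mult)
    have act_sum: "act E (\<Sum>n<N. f n) c = (\<Sum>n<N. act E (f n) c)" if "\<And>n. f n \<in> carrier E" for N :: nat and f
    proof (induction N)
      case 0
      \<comment> \<open>The action on 0 is computed with the scalar 0.\<close>
      show ?case using act_scaleC_left [of 0 0 c] by simp
    qed (simp add: act_add_left sum_closed that)
    have "(\<Sum>n<N. h n (act \<H>\<^sub>A a c n)) = act E (\<Sum>n<N. h n (a n)) c" for N
      using module_morphismD(4) [OF multiplier_morphism [OF standard_frame_multiplier [OF h]]]
        standard_frame_multiplier [OF h]
      by (simp add: act_sum multiplier_closed)
    moreover have "limitin (module_topology E) (\<lambda>N. act E (\<Sum>n<N. h n (a n)) c) (act E (synthesis h a) c) sequentially"
    proof (rule limitin_additive [OF partial_sum_closed [OF h] limitin_synthesis [OF h a]])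
      fix p :: "'a \<Rightarrow> real"
      assume "p \<in> \<S>"
      then interpret cstar_seminormed p by (rule cstar_seminormed)
      have "module_seminorm E p (act E x c) \<le> p c * module_seminorm E p x" if "x \<in> carrier E" for x
      proof -
        have "p (star c * ip E x x * c) \<le> p c * p (ip E x x) * p c"
          by (intro submult_le) (simp_all add: star)
        then have "sqrt (p (ip E (act E x c) (act E x c))) \<le> sqrt ((p c)\<^sup>2 * p (ip E x x))"
          using that by (simp add: ip_act_left ip_act_right act_closed power2_eq_square mult.assoc
              mult.left_commute mult.commute)
        then show ?thesis by (simp add: module_seminorm_def real_sqrt_mult)
      qed
      then show "\<exists>K. \<forall>x\<in>carrier E. module_seminorm E p (act E x c) \<le> K * module_seminorm E p x" by blast
    qed (simp_all add: act_closed act_add_left)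
    ultimately show "limitin (module_topology E) (\<lambda>N. \<Sum>n<N. h n (act \<H>\<^sub>A a c n)) (act E (synthesis h a) c) sequentially"
      by (simp del: sequence_module_simps)
  qed
qed

lemma frame_transform_closed:
  "standard_frame E h \<Longrightarrow> x \<in> carrier E \<Longrightarrow> frame_transform E h x \<in> carrier \<H>\<^sub>A"
  by (simp add: frame_transform_def standard_frame_def)

text \<open>Continuity of the inner product allows pairing the synthesis series term by term. The
  result includes convergence, which \<open>suminf\<close> in the inner product of
  \<open>\<H>\<^sub>A\<close> does not assert by itself.\<close>

lemma frame_transform_sums:
  assumes h: "standard_frame E h" and x: "x \<in> carrier E" and a: "a \<in> carrier \<H>\<^sub>A"
  shows "(\<lambda>n. star (frame_transform E h x n) * a n) sums ip E x (synthesis h a)"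
  using limitin_ip [OF partial_sum_closed [OF h] limitin_synthesis [OF h a] x]
  by (simp add: sums_def ip_partial_sum h x frame_transform_def)

lemma module_adjoint_frame_transform:
  assumes h: "standard_frame E h"
  shows "module_adjoint E \<H>\<^sub>A (frame_transform E h) = synthesis h"
proof (rule module_adjoint_eq)
  have "ip \<H>\<^sub>A (frame_transform E h x) a = ip E x (synthesis h a)"
    if "x \<in> carrier E" "a \<in> carrier \<H>\<^sub>A" for x a
    using sums_unique [OF frame_transform_sums [OF h that]] by simp
  then show "is_module_adjoint E \<H>\<^sub>A (frame_transform E h) (synthesis h)"
    unfolding is_module_adjoint_def using synthesis_morphism [OF h] by blast
qed

text \<open>Both sides concern the limit of the same series, which exists because the frame
  transform of t lands in \<open>\<H>\<^sub>A\<close>, and which is unique.\<close>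

lemma dual_frame_iff:
  assumes h: "standard_frame E h" and t: "standard_frame E t"
  shows "dual_frame E h t \<longleftrightarrow> (\<forall>x\<in>carrier E. synthesis h (frame_transform E t x) = x)"
proof -
  have "limitin (module_topology E) (\<lambda>N. \<Sum>n<N. h n (multiplier_ip E (t n) x)) x sequentially \<longleftrightarrow>
      synthesis h (frame_transform E t x) = x" if "x \<in> carrier E" for x
    using synthesis_eqI [OF h frame_transform_closed [OF t that], of x]
      limitin_synthesis [OF h frame_transform_closed [OF t that]] that
    by (auto simp: frame_transform_def)
  then show ?thesis
    by (auto simp: dual_frame_def h t)
qed

text \<open>Both sides are sums of one series, as \<open>star\<close> passes through limits. It
  expresses that the two mixed compositions are adjoint to each other.\<close>

lemma ip_synthesis_frame_transform:
  assumes h: "standard_frame E h" and t: "standard_frame E t"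
    and x: "x \<in> carrier E" and y: "y \<in> carrier E"
  shows "ip E y (synthesis t (frame_transform E h x)) = star (ip E x (synthesis h (frame_transform E t y)))"
proof -
  have "(\<lambda>n. star (frame_transform E t y n) * frame_transform E h x n) sums
      star (ip E x (synthesis h (frame_transform E t y)))"
    using sums_star [OF frame_transform_sums [OF h x frame_transform_closed [OF t y]]]
    by (simp add: star_simps)
  then show ?thesis
    using frame_transform_sums [OF t y frame_transform_closed [OF h x]] sums_unique2 by blast
qed

lemma dual_frame_commute:
  assumes "dual_frame E h t"
  shows "dual_frame E t h"
proof -
  have h: "standard_frame E h" and t: "standard_frame E t"
    using assms by (simp_all add: dual_frame_def)
  have "synthesis t (frame_transform E h x) = x" if x: "x \<in> carrier E" for x
  proof (rule eqI_ip)
    show "synthesis t (frame_transform E h x) \<in> carrier E"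
      by (intro synthesis_closed frame_transform_closed h t x)
    show "ip E y (synthesis t (frame_transform E h x)) = ip E y x" if "y \<in> carrier E" for y
      using assms that x by (simp add: ip_synthesis_frame_transform h t dual_frame_iff ip_star)
  qed fact
  then show ?thesis by (simp add: dual_frame_iff h t)
qed

end

theorem proposition4p6:
  fixes E :: "('a::pro_cstar_algebra, 'e::complex_vector) cmodule"
    and h t :: "nat \<Rightarrow> 'a \<Rightarrow> 'e"
    and \<theta>1 \<theta>2 :: "'e \<Rightarrow> nat \<Rightarrow> 'a"
  assumes "hilbert_module E"
    and "countably_generated_in_multipliers E"
    and "standard_frame E h"
    and "standard_frame E t"
    and "\<theta>1 = frame_transform E h"
    and "\<theta>2 = frame_transform E t"
  shows "duals_to_each_other E h t \<longleftrightarrow>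
    compose (carrier E) (module_adjoint E \<H>\<^sub>A \<theta>1) \<theta>2 = (\<lambda>x\<in>carrier E. x)"
proof -
  interpret hilbert_module E by fact
  have "compose (carrier E) (module_adjoint E \<H>\<^sub>A \<theta>1) \<theta>2 = (\<lambda>x\<in>carrier E. x) \<longleftrightarrow>
      (\<forall>x\<in>carrier E. synthesis h (frame_transform E t x) = x)"
    \<comment> \<open>Both maps are \<open>undefined\<close> off the carrier, so their equality is
      equality on the carrier.\<close>
    unfolding assms(5,6) module_adjoint_frame_transform [OF assms(3)]
    by (auto simp: compose_def restrict_def fun_eq_iff)
  also have "\<dots> \<longleftrightarrow> dual_frame E h t"
    using assms by (simp add: dual_frame_iff)
  also have "\<dots> \<longleftrightarrow> duals_to_each_other E h t"
    using dual_frame_commute by (auto simp: duals_to_each_other_def)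
  finally show ?thesis by simp
qed

end
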